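(* Let $F$ be a free group and let $R$ be a normal subgroup of $F$. Then $$R\cap \bigl(1+\Delta^3(R)+\Delta(R)\Delta(R\cap F')+\Delta([R,R\cap F'])\bigr)=[R,R\cap F'].$$
   Context: For a group $G$, $\mathbb{Z}G$ is its integral group ring, $\Delta(G)$ is the augmentation ideal of $\mathbb{Z}G$, and $\Delta^n(G)$ is the $n$-th associative power of $\Delta(G)$. For a subgroup $H$ of $R$, $\Delta(H)$ is the augmentation ideal of $\mathbb{Z}H$, regarded as a subset of $\mathbb{Z}R$; a product such as $\Delta(R)\Delta(H)$ is the additive subgroup of $\mathbb{Z}R$ generated by all products $xy$ with $x\in\Delta(R)$, $y\in\Delta(H)$, and sums are sums of additive subgroups. For an additive subgroup $J$ of $\mathbb{Z}R$, $R\cap(1+J)=\{w\in R: w-1\in J\}$. $F'=[F,F]$ is the derived group of $F$, and for subgroups $A,B$ of a group, $[A,B]$ is the subgroup generated by all commutators $[a,b]$ with $a\in A$, $b\in B$. *)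

theory Defs
  imports "HOL-Algebra.Algebra"
begin

section \<open>Free groups\<close>

text \<open>
  A letter \<open>(s, True)\<close> stands for \<open>s\<close> and \<open>(s, False)\<close> for the inverse of \<open>s\<close>.
\<close>

fun letter_value :: "('a, 'm) monoid_scheme \<Rightarrow> ('s \<Rightarrow> 'a) \<Rightarrow> 's \<times> bool \<Rightarrow> 'a" where
  "letter_value G f (s, e) = (if e then f s else inv\<^bsub>G\<^esub> (f s))"

definition word_value :: "('a, 'm) monoid_scheme \<Rightarrow> ('s \<Rightarrow> 'a) \<Rightarrow> ('s \<times> bool) list \<Rightarrow> 'a" where
  "word_value G f w = foldr (\<lambda>l g. letter_value G f l \<otimes>\<^bsub>G\<^esub> g) w \<one>\<^bsub>G\<^esub>"

definition reduced_word :: "('s \<times> bool) list \<Rightarrow> bool" where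
  "reduced_word w \<longleftrightarrow> successively (\<lambda>(s, d) (t, e). s = t \<longrightarrow> d = e) w"

definition reduced_words :: "'s set \<Rightarrow> ('s \<times> bool) list set" where
  "reduced_words S = {w. fst ` set w \<subseteq> S \<and> reduced_word w}"

text \<open>
  A free basis is described by normal forms: every element is the value of exactly one reduced word.
  The universal property cannot serve as the definition, since it quantifies over groups of all
  types; it is derived in \<open>free_basis_universal\<close>.
\<close>

definition free_basis :: "('a, 'm) monoid_scheme \<Rightarrow> 'a set \<Rightarrow> bool" where
  "free_basis G S \<longleftrightarrow> S \<subseteq> carrier G \<and> bij_betw (word_value G (\<lambda>s. s)) (reduced_words S) (carrier G)"

locale free_group = group +
  assumes ex_free_basis: "\<exists>S. free_basis G S"

lemma word_value_simps [simp]: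
  "word_value G f [] = \<one>\<^bsub>G\<^esub>"
  "word_value G f (l # w) = letter_value G f l \<otimes>\<^bsub>G\<^esub> word_value G f w"
  by (simp_all add: word_value_def)

lemma (in group) letter_value_closed:
  "\<lbrakk>f \<in> S \<rightarrow> carrier G; fst l \<in> S\<rbrakk> \<Longrightarrow> letter_value G f l \<in> carrier G"
  by (cases l) auto

lemma (in group) word_value_closed:
  assumes "f \<in> S \<rightarrow> carrier G" "fst ` set w \<subseteq> S"
  shows "word_value G f w \<in> carrier G"
  using assms(2) by (induction w) (auto intro!: letter_value_closed[OF assms(1)])

lemma (in group) word_value_append:
  assumes "f \<in> S \<rightarrow> carrier G" "fst ` set v \<subseteq> S" "fst ` set w \<subseteq> S"
  shows "word_value G f (v @ w) = word_value G f v \<otimes> word_value G f w"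
  using assms(2)
proof (induction v)
  case Nil
  then show ?case using word_value_closed[OF assms(1,3)] by simp
next
  case (Cons l v)
  then have "letter_value G f l \<in> carrier G" "word_value G f v \<in> carrier G"
    using letter_value_closed[OF assms(1)] word_value_closed[OF assms(1)] by auto
  then show ?case using Cons word_value_closed[OF assms(1,3)] by (simp add: m_assoc)
qed

lemma (in group) letter_value_cancel:
  assumes "f \<in> S \<rightarrow> carrier G" "s \<in> S" "g \<in> carrier G" "d \<noteq> e"
  shows "letter_value G f (s, d) \<otimes> (letter_value G f (s, e) \<otimes> g) = g"
proof -
  have "f s \<in> carrier G" using assms by auto
  then show ?thesis using assms(3,4) by (cases d; cases e) (auto simp flip: m_assoc)
qed

lemma free_basis_universal:
  assumes "group G" "group H" and basis: "free_basis G S" and f: "f \<in> S \<rightarrow> carrier H"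
  shows "\<exists>h \<in> hom G H. \<forall>s\<in>S. h s = f s"
proof -
  interpret G: group G by fact
  interpret H: group H by fact
  let ?g = "word_value G (\<lambda>s. s)" and ?h = "word_value H f"
  have id: "(\<lambda>s. s) \<in> S \<rightarrow> carrier G" and bij: "bij_betw ?g (reduced_words S) (carrier G)"
    using basis by (auto simp: free_basis_def)
  define h where "h = (\<lambda>x. ?h (inv_into (reduced_words S) ?g x))"
  have h_red: "h (?g r) = ?h r" if "r \<in> reduced_words S" for r
    using that bij by (simp add: h_def bij_betw_def)
  have h_word: "h (?g w) = ?h w" if "fst ` set w \<subseteq> S" for w
    using that
  proof (induction w)
    case Nil
    show ?case using h_red[of "[]"] by (simp add: reduced_words_def reduced_word_def)
  next
    case (Cons l w)
    obtain s d where l: "l = (s, d)" by (cases l)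
    have s: "s \<in> S" and w: "fst ` set w \<subseteq> S" using Cons.prems l by auto
    have "?g w \<in> ?g ` reduced_words S"
      using G.word_value_closed[OF id w] bij by (simp add: bij_betw_def)
    then obtain r where r: "r \<in> reduced_words S" "?g w = ?g r" by auto
    have hr: "?h w = ?h r" using Cons.IH[OF w] h_red[OF r(1)] r(2) by simp
    show ?case
    proof (cases "l # r \<in> reduced_words S")
      case True
      have "h (?g (l # w)) = h (?g (l # r))" using r(2) by simp
      also have "\<dots> = ?h (l # r)" by (rule h_red[OF True])
      finally show ?thesis using hr by simp
    next
      case False
      have "r \<noteq> []" using False s l by (auto simp: reduced_words_def reduced_word_def)
      then obtain t e r' where r_eq: "r = (t, e) # r'" by (metis list.exhaust surj_pair)
      then have r': "t = s" "d \<noteq> e" "r' \<in> reduced_words S"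
        using r(1) s False unfolding l
        by (auto simp: reduced_words_def reduced_word_def successively_Cons)
      note r' = r_eq[unfolded r'(1)] r'(2,3)
      have rc: "fst ` set r' \<subseteq> S" using r'(3) by (simp add: reduced_words_def)
      have "?g (l # w) = ?g r'"
        using r(2) r'(1) l
          G.letter_value_cancel[OF id s G.word_value_closed[OF id rc] r'(2)] by simp
      moreover have "?h (l # w) = ?h r'"
        using hr r'(1) l H.letter_value_cancel[OF f s H.word_value_closed[OF f rc] r'(2)] by simp
      ultimately show ?thesis using h_red[OF r'(3)] by simp
    qed
  qed
  have ex: "\<exists>w. fst ` set w \<subseteq> S \<and> x = ?g w" if "x \<in> carrier G" for x
  proof -
    have "x \<in> ?g ` reduced_words S" using that bij by (simp add: bij_betw_def)
    then show ?thesis by (auto simp: reduced_words_def)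
  qed
  have "h \<in> hom G H"
  proof (rule homI)
    fix x assume "x \<in> carrier G"
    then obtain w where "fst ` set w \<subseteq> S" "x = ?g w" using ex by blast
    then show "h x \<in> carrier H" using h_word H.word_value_closed[OF f] by simp
  next
    fix x y assume "x \<in> carrier G" "y \<in> carrier G"
    then obtain v w where vw: "fst ` set v \<subseteq> S" "x = ?g v" "fst ` set w \<subseteq> S" "y = ?g w"
      using ex by meson
    then have "h (x \<otimes>\<^bsub>G\<^esub> y) = h (?g (v @ w))" using G.word_value_append[OF id] by simp
    also have "\<dots> = ?h (v @ w)" using vw by (intro h_word) auto
    finally show "h (x \<otimes>\<^bsub>G\<^esub> y) = h x \<otimes>\<^bsub>H\<^esub> h y"
      using vw h_word H.word_value_append[OF f] by simp
  qed
  moreover have "h s = f s" if "s \<in> S" for s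
  proof -
    have "s \<in> carrier G" "f s \<in> carrier H" using that id f by auto
    then show ?thesis using h_word[of "[(s, True)]"] that by simp
  qed
  ultimately show ?thesis by blast
qed


section \<open>Commutator subgroups\<close>

text \<open>
  The commutator convention is that of \<^const>\<open>derived\<close>, which is the case \<open>A = B\<close>.
\<close>

definition commutator_subgroup :: "('a, 'm) monoid_scheme \<Rightarrow> 'a set \<Rightarrow> 'a set \<Rightarrow> 'a set" where
  "commutator_subgroup G A B =
     generate G (\<Union>a\<in>A. \<Union>b\<in>B. {a \<otimes>\<^bsub>G\<^esub> b \<otimes>\<^bsub>G\<^esub> inv\<^bsub>G\<^esub> a \<otimes>\<^bsub>G\<^esub> inv\<^bsub>G\<^esub> b})"

lemma derived_eq_commutator_subgroup: "derived G A = commutator_subgroup G A A"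
  by (simp add: derived_def commutator_subgroup_def)


section \<open>Integral group rings\<close>

text \<open>
  The additive group is the one of \<^const>\<open>free_Abelian_group\<close>: integer-valued functions with finite
  support inside the carrier of \<open>G\<close>, where \<^term>\<open>frag_of g\<close> is the group element \<open>g\<close>. For a
  subgroup \<open>H\<close> of \<open>G\<close>, the carrier of the group ring of \<open>G\<lparr>carrier := H\<rparr>\<close> is thus literally a subset
  of the carrier of the group ring of \<open>G\<close>. The product is the bilinear extension of the product
  of \<open>G\<close>.
\<close>

definition group_ring :: "('a, 'm) monoid_scheme \<Rightarrow> ('a \<Rightarrow>\<^sub>0 int) ring" where
  "group_ring G =
     \<lparr>carrier = {x. Poly_Mapping.keys x \<subseteq> carrier G},
      monoid.mult = (\<lambda>x y. frag_extend (\<lambda>g. frag_extend (\<lambda>h. frag_of (g \<otimes>\<^bsub>G\<^esub> h)) y) x),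
      one = frag_of \<one>\<^bsub>G\<^esub>, ring.zero = 0, ring.add = (+)\<rparr>"

definition augmentation :: "('a \<Rightarrow>\<^sub>0 int) \<Rightarrow> int" where
  "augmentation x = (\<Sum>g\<in>Poly_Mapping.keys x. Poly_Mapping.lookup x g)"

definition augmentation_ideal :: "('a, 'm) monoid_scheme \<Rightarrow> ('a \<Rightarrow>\<^sub>0 int) set" (\<open>\<Delta>\<close>) where
  "\<Delta> G = {x \<in> carrier (group_ring G). augmentation x = 0}"

definition additive_product :: "('a, 'm) ring_scheme \<Rightarrow> 'a set \<Rightarrow> 'a set \<Rightarrow> 'a set" where
  "additive_product A I J = generate (add_monoid A) {x \<otimes>\<^bsub>A\<^esub> y | x y. x \<in> I \<and> y \<in> J}"

primrec augmentation_power :: "('a, 'm) monoid_scheme \<Rightarrow> nat \<Rightarrow> ('a \<Rightarrow>\<^sub>0 int) set" where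
  "augmentation_power G 0 = carrier (group_ring G)"
| "augmentation_power G (Suc n) = additive_product (group_ring G) (augmentation_power G n) (\<Delta> G)"

text \<open>The set \<open>G \<inter> (1 + J)\<close> for an additive subgroup \<open>J\<close> of the group ring of \<open>G\<close>.\<close>

definition one_plus_inter :: "('a, 'm) monoid_scheme \<Rightarrow> ('a \<Rightarrow>\<^sub>0 int) set \<Rightarrow> 'a set" where
  "one_plus_inter G J =
     {w \<in> carrier G. frag_of w \<ominus>\<^bsub>group_ring G\<^esub> \<one>\<^bsub>group_ring G\<^esub> \<in> J}"

lemma group_ring_simps [simp]:
  "x \<in> carrier (group_ring G) \<longleftrightarrow> Poly_Mapping.keys x \<subseteq> carrier G"
  "\<one>\<^bsub>group_ring G\<^esub> = frag_of \<one>\<^bsub>G\<^esub>"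
  "\<zero>\<^bsub>group_ring G\<^esub> = 0"
  "x \<oplus>\<^bsub>group_ring G\<^esub> y = x + y"
  by (simp_all add: group_ring_def)

lemma group_ring_mult:
  "x \<otimes>\<^bsub>group_ring G\<^esub> y = frag_extend (\<lambda>g. frag_extend (\<lambda>h. frag_of (g \<otimes>\<^bsub>G\<^esub> h)) y) x"
  by (simp add: group_ring_def)

lemma add_monoid_group_ring:
  "monoid.truncate (add_monoid (group_ring G)) = free_Abelian_group (carrier G)"
  by (simp add: group_ring_def free_Abelian_group_def monoid.defs)

lemma (in group) ring_group_ring: "ring (group_ring G)"
proof -
  let ?A = "group_ring G"
  let ?K = "\<lambda>x. Poly_Mapping.keys x \<subseteq> carrier G"
  have closed: "?K (x \<otimes>\<^bsub>?A\<^esub> y)" if "?K x" "?K y" for x y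
    unfolding group_ring_mult using that
    by (intro order_trans[OF keys_frag_extend] UN_least) auto
  have distl: "(x + y) \<otimes>\<^bsub>?A\<^esub> z = x \<otimes>\<^bsub>?A\<^esub> z + y \<otimes>\<^bsub>?A\<^esub> z" for x y z
    by (simp add: group_ring_mult frag_extend_add)
  have diffl: "(x - y) \<otimes>\<^bsub>?A\<^esub> z = x \<otimes>\<^bsub>?A\<^esub> z - y \<otimes>\<^bsub>?A\<^esub> z" for x y z
    by (simp add: group_ring_mult frag_extend_diff)
  have zl: "0 \<otimes>\<^bsub>?A\<^esub> z = 0" for z by (simp add: group_ring_mult)
  have zr: "z \<otimes>\<^bsub>?A\<^esub> 0 = 0" for z
    by (simp add: group_ring_mult frag_extend_def)
  have distr: "z \<otimes>\<^bsub>?A\<^esub> (x + y) = z \<otimes>\<^bsub>?A\<^esub> x + z \<otimes>\<^bsub>?A\<^esub> y" for x y z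
    unfolding group_ring_mult frag_extend_add
    by (simp add: frag_extend_def[of _ z] frag_cmul_distrib2 sum.distrib)
  have diffr: "z \<otimes>\<^bsub>?A\<^esub> (x - y) = z \<otimes>\<^bsub>?A\<^esub> x - z \<otimes>\<^bsub>?A\<^esub> y" for x y z
    using distr[of z "x - y" y] by simp
  have of: "frag_of g \<otimes>\<^bsub>?A\<^esub> frag_of h = frag_of (g \<otimes> h)" for g h
    by (simp add: group_ring_mult)
  have onel: "?K x \<Longrightarrow> frag_of \<one> \<otimes>\<^bsub>?A\<^esub> x = x" for x
    by (induction x rule: free_Abelian_group_induct[where S = "carrier G", consumes 1]) (auto simp: zr diffr of)
  have oner: "?K x \<Longrightarrow> x \<otimes>\<^bsub>?A\<^esub> frag_of \<one> = x" for x
    by (induction x rule: free_Abelian_group_induct[where S = "carrier G", consumes 1]) (auto simp: zl diffl of)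
  have assoc1: "?K z \<Longrightarrow> g \<in> carrier G \<Longrightarrow> h \<in> carrier G \<Longrightarrow>
      frag_of g \<otimes>\<^bsub>?A\<^esub> frag_of h \<otimes>\<^bsub>?A\<^esub> z = frag_of g \<otimes>\<^bsub>?A\<^esub> (frag_of h \<otimes>\<^bsub>?A\<^esub> z)" for z g h
    by (induction z rule: free_Abelian_group_induct[where S = "carrier G", consumes 1]) (auto simp: zr diffr of m_assoc)
  have assoc2: "?K y \<Longrightarrow> ?K z \<Longrightarrow> g \<in> carrier G \<Longrightarrow>
      frag_of g \<otimes>\<^bsub>?A\<^esub> y \<otimes>\<^bsub>?A\<^esub> z = frag_of g \<otimes>\<^bsub>?A\<^esub> (y \<otimes>\<^bsub>?A\<^esub> z)" for y z g
    by (induction y rule: free_Abelian_group_induct[where S = "carrier G", consumes 1]) (auto simp: zr zl diffr diffl assoc1)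
  have assoc: "?K x \<Longrightarrow> ?K y \<Longrightarrow> ?K z \<Longrightarrow> x \<otimes>\<^bsub>?A\<^esub> y \<otimes>\<^bsub>?A\<^esub> z = x \<otimes>\<^bsub>?A\<^esub> (y \<otimes>\<^bsub>?A\<^esub> z)" for x y z
    by (induction x rule: free_Abelian_group_induct[where S = "carrier G", consumes 1]) (auto simp: zl diffl assoc2)
  show ?thesis
  proof (rule ringI)
    show "abelian_group ?A"
    proof (rule abelian_groupI)
      fix x assume "x \<in> carrier ?A"
      then show "\<exists>y\<in>carrier ?A. y \<oplus>\<^bsub>?A\<^esub> x = \<zero>\<^bsub>?A\<^esub>" by (intro bexI[of _ "- x"]) auto
    qed (auto simp: ac_simps dest: subsetD[OF keys_add])
    show "monoid ?A"
      by (rule monoidI) (auto simp del: group_ring_simps(3,4) simp: onel oner assoc intro: closed[THEN subsetD])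
  qed (auto simp: distl distr)
qed

lemma (in group) group_ring_minus:
  assumes "x \<in> carrier (group_ring G)" "y \<in> carrier (group_ring G)"
  shows "x \<ominus>\<^bsub>group_ring G\<^esub> y = x - y"
proof -
  interpret A: ring "group_ring G" by (rule ring_group_ring)
  have "\<ominus>\<^bsub>group_ring G\<^esub> y = - y" using assms by (intro A.minus_equality) auto
  then show ?thesis by (simp add: a_minus_def)
qed

end

theory Submission
  imports Defs
begin

text \<open>
  Let \<open>S = R \<inter> F'\<close> and \<open>N = [R, S]\<close>. Modulo \<open>N\<close>, the subgroup \<open>S\<close> becomes a central subgroup
  \<open>Q = S/N\<close> of \<open>R/N\<close>, with quotient \<open>R/S\<close> embedded in the free abelian group \<open>F/F'\<close>. A central
  extension of a free abelian group is given by a bilinear cocycle, so the projection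
  \<open>S \<rightarrow> Q\<close> extends to a map \<open>\<phi>\<close> on \<open>R\<close> for which \<open>\<beta>(g, h) = \<phi>(gh) - \<phi>(g) - \<phi>(h)\<close> is bilinear and
  trivial on \<open>S\<close>. The additive extension of \<open>\<phi>\<close> to \<open>\<int>R\<close> maps \<open>(g - 1)(h - 1)\<close> to \<open>\<beta>(g, h)\<close>, hence
  kills \<open>\<Delta>\<^sup>3(R)\<close>, \<open>\<Delta>(R)\<Delta>(S)\<close> and \<open>\<Delta>(N)\<close>. An element \<open>w\<close> of the left-hand side lies in \<open>S\<close>, because
  \<open>R \<rightarrow> F/F'\<close> extends additively to a map that kills \<open>\<Delta>\<^sup>2(R)\<close>, and then \<open>\<phi>(w) = 0\<close> says \<open>w \<in> N\<close>.
  To avoid bases of subgroups of free abelian groups of infinite rank, \<open>\<phi>\<close> is only constructed on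
  the elements of \<open>R\<close> whose image in \<open>F/F'\<close> is supported in a given finite set of generators.
\<close>

section \<open>Additive subgroups of the group ring\<close>

lemma group_ring_mult_diff_left:
  "(x - y) \<otimes>\<^bsub>group_ring G\<^esub> z = x \<otimes>\<^bsub>group_ring G\<^esub> z - y \<otimes>\<^bsub>group_ring G\<^esub> z"
  by (simp add: group_ring_mult frag_extend_diff)

lemma group_ring_mult_diff_right:
  "z \<otimes>\<^bsub>group_ring G\<^esub> (x - y) = z \<otimes>\<^bsub>group_ring G\<^esub> x - z \<otimes>\<^bsub>group_ring G\<^esub> y"
proof -
  have "z \<otimes>\<^bsub>group_ring G\<^esub> (u + v) = z \<otimes>\<^bsub>group_ring G\<^esub> u + z \<otimes>\<^bsub>group_ring G\<^esub> v" for u v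
    unfolding group_ring_mult frag_extend_add
    by (simp add: frag_extend_def[of _ z] frag_cmul_distrib2 sum.distrib)
  from this[of "x - y" y] show ?thesis by simp
qed

lemma group_ring_mult_zero_left: "0 \<otimes>\<^bsub>group_ring G\<^esub> z = 0"
  by (simp add: group_ring_mult)

lemma group_ring_mult_zero_right: "z \<otimes>\<^bsub>group_ring G\<^esub> 0 = 0"
  by (simp add: group_ring_mult frag_extend_def)

lemma group_ring_mult_frag_of:
  "frag_of g \<otimes>\<^bsub>group_ring G\<^esub> frag_of h = frag_of (g \<otimes>\<^bsub>G\<^esub> h)"
  by (simp add: group_ring_mult)

lemma augmentation_eq_sum:
  assumes "finite A" "Poly_Mapping.keys x \<subseteq> A"
  shows "augmentation x = (\<Sum>g\<in>A. Poly_Mapping.lookup x g)"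
  unfolding augmentation_def using assms
  by (intro sum.mono_neutral_left) (auto simp: in_keys_iff)

lemma augmentation_diff: "augmentation (x - y) = augmentation x - augmentation y"
proof -
  let ?A = "Poly_Mapping.keys x \<union> Poly_Mapping.keys y"
  have "Poly_Mapping.keys (x - y) \<subseteq> ?A" by (rule keys_diff)
  then have "augmentation (x - y) = (\<Sum>g\<in>?A. Poly_Mapping.lookup (x - y) g)"
    by (intro augmentation_eq_sum) auto
  also have "\<dots> = augmentation x - augmentation y"
    by (simp add: lookup_minus sum_subtractf augmentation_eq_sum[of ?A])
  finally show ?thesis .
qed

lemma augmentation_frag_of [simp]: "augmentation (frag_of g) = 1"
  by (simp add: augmentation_def)

lemma augmentation_zero [simp]: "augmentation 0 = 0"
  by (simp add: augmentation_def)

text \<open>Additive subgroups, phrased by differences because \<open>frag_induction\<close> builds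
  every element of the group ring from group elements by differences. They serve as test sets: an
  inclusion in one of them is checked on generators only.\<close>

definition diff_closed :: "'b::group_add set \<Rightarrow> bool" where
  "diff_closed M \<longleftrightarrow> 0 \<in> M \<and> (\<forall>x\<in>M. \<forall>y\<in>M. x - y \<in> M)"

lemma diff_closedD:
  assumes "diff_closed M"
  shows "0 \<in> M" "\<And>x y. x \<in> M \<Longrightarrow> y \<in> M \<Longrightarrow> x - y \<in> M" "\<And>x. x \<in> M \<Longrightarrow> - x \<in> M"
    "\<And>x y. x \<in> M \<Longrightarrow> y \<in> M \<Longrightarrow> x + y \<in> M"
proof -
  show z: "0 \<in> M" and d: "\<And>x y. x \<in> M \<Longrightarrow> y \<in> M \<Longrightarrow> x - y \<in> M"
    using assms by (auto simp: diff_closed_def)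
  show m: "- x \<in> M" if "x \<in> M" for x using d[OF z that] by simp
  show "x + y \<in> M" if "x \<in> M" "y \<in> M" for x y using d[OF that(1) m[OF that(2)]] by simp
qed

lemma diff_closed_Int: "diff_closed M \<Longrightarrow> diff_closed N \<Longrightarrow> diff_closed (M \<inter> N)"
  by (auto simp: diff_closed_def)

lemma diff_closed_mult_left: "diff_closed M \<Longrightarrow> diff_closed {x. x \<otimes>\<^bsub>group_ring G\<^esub> z \<in> M}"
  by (auto simp: diff_closed_def group_ring_mult_diff_left group_ring_mult_zero_left)

lemma diff_closed_mult_right: "diff_closed M \<Longrightarrow> diff_closed {x. z \<otimes>\<^bsub>group_ring G\<^esub> x \<in> M}"
  by (auto simp: diff_closed_def group_ring_mult_diff_right group_ring_mult_zero_right)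

lemma carrier_group_ring_carrier_update:
  "carrier (group_ring (G\<lparr>carrier := H\<rparr>)) = {x. Poly_Mapping.keys x \<subseteq> H}"
  by (simp add: group_ring_def)

text \<open>Augmentation zero turns \<open>x\<close> into an integer combination of the differences
  \<open>frag_of h - frag_of u\<close>. In the applications the base point \<open>u\<close> is the
  identity.\<close>

lemma augmentation_ideal_subset:
  assumes M: "diff_closed M" and H: "\<And>h. h \<in> H \<Longrightarrow> frag_of h - frag_of u \<in> M"
  shows "\<Delta> (G\<lparr>carrier := H\<rparr>) \<subseteq> M"
proof
  fix x assume "x \<in> \<Delta> (G\<lparr>carrier := H\<rparr>)"
  then have x: "Poly_Mapping.keys x \<subseteq> H" "augmentation x = 0"
    by (auto simp: augmentation_ideal_def carrier_group_ring_carrier_update simp del: group_ring_simps(1))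
  \<comment> \<open>The induction passes through elements of nonzero augmentation, so it runs over
    all \<open>x\<close>, corrected by the multiple of \<open>u\<close> that restores augmentation
    zero.\<close>
  have "x - frag_cmul (augmentation x) (frag_of u) \<in> M" using x(1)
  proof (induction x rule: frag_induction)
    case (diff a b)
    have eq: "a - b - frag_cmul (augmentation (a - b)) (frag_of u)
      = (a - frag_cmul (augmentation a) (frag_of u)) - (b - frag_cmul (augmentation b) (frag_of u))"
      by (simp add: augmentation_diff frag_cmul_diff_distrib)
    show ?case unfolding eq by (rule diff_closedD(2)[OF M diff])
  qed (use H diff_closedD(1)[OF M] in auto)
  with x(2) show "x \<in> M" by simp
qed

lemma frag_of_diff_in_augmentation_ideal:
  assumes "g \<in> carrier G" "h \<in> carrier G"
  shows "frag_of g - frag_of h \<in> \<Delta> G"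
  using assms keys_diff[of "frag_of g" "frag_of h"]
  by (auto simp: augmentation_ideal_def augmentation_diff)

lemma diff_closed_augmentation_ideal: "diff_closed (\<Delta> G)"
  using keys_diff by (fastforce simp: diff_closed_def augmentation_ideal_def augmentation_diff)

section \<open>Products and powers of augmentation ideals, reduced to generators\<close>

lemma (in group) group_ring_uminus:
  assumes "x \<in> carrier (group_ring G)"
  shows "\<ominus>\<^bsub>group_ring G\<^esub> x = - x"
proof -
  interpret A: ring "group_ring G" by (rule ring_group_ring)
  show ?thesis using assms by (intro A.minus_equality) auto
qed

lemma (in group) additive_product_subset:
  assumes M: "diff_closed M"
    and I: "I \<subseteq> carrier (group_ring G)" and J: "J \<subseteq> carrier (group_ring G)"
    and IJ: "\<And>x y. x \<in> I \<Longrightarrow> y \<in> J \<Longrightarrow> x \<otimes>\<^bsub>group_ring G\<^esub> y \<in> M"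
  shows "additive_product (group_ring G) I J \<subseteq> M"
proof
  interpret A: ring "group_ring G" by (rule ring_group_ring)
  fix z assume "z \<in> additive_product (group_ring G) I J"
  then show "z \<in> M" unfolding additive_product_def
  proof (induction z rule: generate.induct)
    case one
    show ?case using diff_closedD(1)[OF M] by simp
  next
    case (incl h)
    then show ?case using IJ by auto
  next
    case (inv h)
    then obtain x y where xy: "h = x \<otimes>\<^bsub>group_ring G\<^esub> y" "x \<in> I" "y \<in> J" by auto
    have "x \<otimes>\<^bsub>group_ring G\<^esub> y \<in> carrier (group_ring G)"
      using xy(2,3) I J by (intro A.m_closed) blast+
    then have "\<ominus>\<^bsub>group_ring G\<^esub> h = - h" using xy(1) by (simp only: group_ring_uminus)
    moreover have "inv\<^bsub>add_monoid (group_ring G)\<^esub> h = \<ominus>\<^bsub>group_ring G\<^esub> h" by (simp add: a_inv_def)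
    ultimately show ?case using diff_closedD(3)[OF M] IJ[OF xy(2,3)] xy(1) by simp
  next
    case (eng h1 h2)
    then show ?case using diff_closedD(4)[OF M] by simp
  qed
qed

lemma (in group) additive_product_in_carrier:
  assumes "I \<subseteq> carrier (group_ring G)" "J \<subseteq> carrier (group_ring G)"
  shows "additive_product (group_ring G) I J \<subseteq> carrier (group_ring G)"
proof -
  interpret A: ring "group_ring G" by (rule ring_group_ring)
  have "{x \<otimes>\<^bsub>group_ring G\<^esub> y | x y. x \<in> I \<and> y \<in> J} \<subseteq> carrier (add_monoid (group_ring G))"
    using assms by (auto simp del: group_ring_simps intro!: A.m_closed)
  from group.generate_incl[OF A.a_group this] show ?thesis
    unfolding additive_product_def by (simp del: group_ring_simps)
qed

lemma augmentation_ideal_in_carrier: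
  assumes "H \<subseteq> carrier G"
  shows "\<Delta> (G\<lparr>carrier := H\<rparr>) \<subseteq> carrier (group_ring G)"
  using assms by (auto simp: augmentation_ideal_def)

lemma (in group) augmentation_power_in_carrier:
  "augmentation_power G n \<subseteq> carrier (group_ring G)"
proof (induction n)
  case (Suc n)
  have "\<Delta> G \<subseteq> carrier (group_ring G)" using augmentation_ideal_in_carrier[of "carrier G" G] by simp
  with Suc show ?case by (simp add: additive_product_in_carrier del: group_ring_simps)
qed simp

text \<open>The powers start from the whole group ring, so the first one is a product with it;
  nothing new arises because g(h - 1) = gh - g.\<close>

lemma (in group) augmentation_power_Suc_0_subset: "augmentation_power G (Suc 0) \<subseteq> \<Delta> G"
proof -
  have sub: "\<Delta> G \<subseteq> {y. x \<otimes>\<^bsub>group_ring G\<^esub> y \<in> \<Delta> G}" if "Poly_Mapping.keys x \<subseteq> carrier G" for x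
  proof -
    have "frag_of h - frag_of \<one> \<in> {y. x \<otimes>\<^bsub>group_ring G\<^esub> y \<in> \<Delta> G}" if h: "h \<in> carrier G" for h
      using \<open>Poly_Mapping.keys x \<subseteq> carrier G\<close> h
    proof (induction x rule: frag_induction)
      case zero
      show ?case by (simp add: group_ring_mult_zero_left diff_closedD(1)[OF diff_closed_augmentation_ideal])
    next
      case (one g)
      then show ?case
        by (simp add: group_ring_mult_diff_right group_ring_mult_frag_of frag_of_diff_in_augmentation_ideal)
    next
      case (diff a b)
      then show ?case
        by (simp add: group_ring_mult_diff_left diff_closedD(2)[OF diff_closed_augmentation_ideal])
    qed
    from augmentation_ideal_subset[OF diff_closed_mult_right[OF diff_closed_augmentation_ideal] this, of "carrier G" G]
    show ?thesis by simp
  qed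
  have "\<Delta> G \<subseteq> carrier (group_ring G)" using augmentation_ideal_in_carrier[of "carrier G" G] by simp
  then have "additive_product (group_ring G) (carrier (group_ring G)) (\<Delta> G) \<subseteq> \<Delta> G"
    using sub by (intro additive_product_subset diff_closed_augmentation_ideal) auto
  then show ?thesis by simp
qed

text \<open>For fixed \<open>x\<close>, the \<open>y\<close> with xy in \<open>M\<close> form an
  additive subgroup, so the last factor may be taken of the form g - 1.\<close>

lemma (in group) augmentation_power_Suc_subset:
  assumes M: "diff_closed M"
    and gen: "\<And>x g. x \<in> augmentation_power G n \<Longrightarrow> g \<in> carrier G \<Longrightarrow>
      x \<otimes>\<^bsub>group_ring G\<^esub> (frag_of g - frag_of \<one>) \<in> M"
  shows "augmentation_power G (Suc n) \<subseteq> M"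
proof -
  have "\<Delta> G \<subseteq> {y. x \<otimes>\<^bsub>group_ring G\<^esub> y \<in> M}" if "x \<in> augmentation_power G n" for x
    using augmentation_ideal_subset[OF diff_closed_mult_right[OF M, of G x], of "carrier G" \<one> G] gen[OF that]
    by simp
  then show ?thesis
    using augmentation_power_in_carrier[of n] augmentation_ideal_in_carrier[of "carrier G" G]
    unfolding augmentation_power.simps by (intro additive_product_subset[OF M]) auto
qed

lemma (in group) augmentation_power_3_subset:
  assumes M: "diff_closed M"
    and gen: "\<And>g h k. g \<in> carrier G \<Longrightarrow> h \<in> carrier G \<Longrightarrow> k \<in> carrier G \<Longrightarrow>
      (frag_of g - frag_of \<one>) \<otimes>\<^bsub>group_ring G\<^esub> (frag_of h - frag_of \<one>)
        \<otimes>\<^bsub>group_ring G\<^esub> (frag_of k - frag_of \<one>) \<in> M"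
  shows "augmentation_power G 3 \<subseteq> M"
proof -
  let ?d = "\<lambda>g. frag_of g - frag_of \<one>"
  \<comment> \<open>Factors are peeled off from the right: \<open>?M1 k\<close> is the test set for
    the second power, \<open>?M2 h k\<close> the one for the first power.\<close>
  let ?M1 = "\<lambda>k. {x. x \<otimes>\<^bsub>group_ring G\<^esub> ?d k \<in> M}"
  let ?M2 = "\<lambda>h k. {x. x \<otimes>\<^bsub>group_ring G\<^esub> ?d h \<in> ?M1 k}"
  have M1: "diff_closed (?M1 k)" for k by (rule diff_closed_mult_left[OF M])
  have M2: "diff_closed (?M2 h k)" for h k by (rule diff_closed_mult_left[OF M1])
  have "\<Delta> G \<subseteq> ?M2 h k" if "h \<in> carrier G" "k \<in> carrier G" for h k
    using augmentation_ideal_subset[OF M2[of h k], of "carrier G" \<one> G] gen that by simp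
  then have "augmentation_power G (Suc (Suc 0)) \<subseteq> ?M1 k" if "k \<in> carrier G" for k
    using augmentation_power_Suc_0_subset that
    by (intro augmentation_power_Suc_subset[OF M1]) blast
  then show ?thesis
    unfolding numeral_3_eq_3 by (intro augmentation_power_Suc_subset[OF M]) blast
qed

lemma (in group) augmentation_ideal_product_subset:
  assumes M: "diff_closed M" and "H \<subseteq> carrier G" "K \<subseteq> carrier G"
    and gen: "\<And>h k. h \<in> H \<Longrightarrow> k \<in> K \<Longrightarrow>
      (frag_of h - frag_of \<one>) \<otimes>\<^bsub>group_ring G\<^esub> (frag_of k - frag_of \<one>) \<in> M"
  shows "additive_product (group_ring G) (\<Delta> (G\<lparr>carrier := H\<rparr>)) (\<Delta> (G\<lparr>carrier := K\<rparr>)) \<subseteq> M"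
proof (rule additive_product_subset[OF M])
  fix x y assume x: "x \<in> \<Delta> (G\<lparr>carrier := H\<rparr>)" and y: "y \<in> \<Delta> (G\<lparr>carrier := K\<rparr>)"
  have "\<Delta> (G\<lparr>carrier := H\<rparr>) \<subseteq> {x. x \<otimes>\<^bsub>group_ring G\<^esub> (frag_of k - frag_of \<one>) \<in> M}" if "k \<in> K" for k
    using gen that by (intro augmentation_ideal_subset[OF diff_closed_mult_left[OF M]]) auto
  with x have "\<Delta> (G\<lparr>carrier := K\<rparr>) \<subseteq> {y. x \<otimes>\<^bsub>group_ring G\<^esub> y \<in> M}"
    by (intro augmentation_ideal_subset[OF diff_closed_mult_right[OF M]]) auto
  with y show "x \<otimes>\<^bsub>group_ring G\<^esub> y \<in> M" by auto
qed (use assms(2,3) in \<open>simp_all add: augmentation_ideal_in_carrier del: group_ring_simps\<close>)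

section \<open>Central extensions of subgroups of free abelian groups\<close>

text \<open>In the application \<open>G\<close> is R, \<open>Q\<close> is S/N, \<open>E\<close> is
  the restriction to R of the abelianization of F in coordinates of a free basis, and
  \<open>p\<close> is the projection of S onto S/N. \<open>p_conj\<close> expresses that S/N is
  central in R/N without forming R/N.\<close>

locale free_abelian_kernel = group G + Q: comm_group Q
  for G (structure) and Q :: "('b, 'n) monoid_scheme" +
  fixes B :: "'x set" and E :: "'a \<Rightarrow> 'x \<Rightarrow>\<^sub>0 int" and p :: "'a \<Rightarrow> 'b" and S :: "'a set"
  assumes S_def: "S = {g \<in> carrier G. E g = 0}"
    and E_hom: "E \<in> hom G (free_Abelian_group B)"
    and p_hom: "p \<in> hom (G\<lparr>carrier := S\<rparr>) Q"
    and p_conj: "\<And>g s. g \<in> carrier G \<Longrightarrow> s \<in> S \<Longrightarrow> p (g \<otimes> s \<otimes> inv g) = p s"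
begin

text \<open>The filtration along which \<open>p\<close> is extended, one coordinate at a time: empty
  \<open>T\<close> gives \<open>S\<close>, and every element is reached by a finite
  \<open>T\<close>.\<close>

definition supp_subgroup :: "'x set \<Rightarrow> 'a set" where
  "supp_subgroup T = {g \<in> carrier G. Poly_Mapping.keys (E g) \<subseteq> T}"

definition commutator_value :: "'a \<Rightarrow> 'a \<Rightarrow> 'b" where
  "commutator_value g h = p (g \<otimes> h \<otimes> inv g \<otimes> inv h)"

text \<open>\<beta> is the cocycle measuring how far \<phi> is from a homomorphism. Multiplicativity
  is demanded in the first argument; in the second it follows by comparing \<phi>((gh)k) with
  \<phi>(g(hk)). Triviality on \<open>S\<close> from both sides keeps factors from \<open>S\<close>
  invisible to the cocycle.\<close>

definition quadratic_extension :: "'x set \<Rightarrow> ('a \<Rightarrow> 'b) \<Rightarrow> ('a \<Rightarrow> 'a \<Rightarrow> 'b) \<Rightarrow> bool" where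
  "quadratic_extension T \<phi> \<beta> \<longleftrightarrow>
     (\<forall>g\<in>supp_subgroup T. \<phi> g \<in> carrier Q) \<and>
     (\<forall>g\<in>supp_subgroup T. \<forall>h\<in>supp_subgroup T. \<beta> g h \<in> carrier Q) \<and>
     (\<forall>s\<in>S. \<phi> s = p s) \<and>
     (\<forall>g\<in>supp_subgroup T. \<forall>h\<in>supp_subgroup T. \<phi> (g \<otimes> h) = \<phi> g \<otimes>\<^bsub>Q\<^esub> \<phi> h \<otimes>\<^bsub>Q\<^esub> \<beta> g h) \<and>
     (\<forall>g\<in>supp_subgroup T. \<forall>h\<in>supp_subgroup T. \<forall>k\<in>supp_subgroup T.
        \<beta> (g \<otimes> h) k = \<beta> g k \<otimes>\<^bsub>Q\<^esub> \<beta> h k) \<and>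
     (\<forall>g\<in>supp_subgroup T. \<forall>s\<in>S. \<beta> g s = \<one>\<^bsub>Q\<^esub> \<and> \<beta> s g = \<one>\<^bsub>Q\<^esub>)"

section \<open>Elementary properties of \<open>E\<close>, \<open>S\<close> and
  \<open>p\<close>\<close>

lemma E_group_hom: "group_hom G (free_Abelian_group B) E"
  using E_hom by (simp add: group_hom_def group_hom_axioms_def is_group)

lemma E_keys: "g \<in> carrier G \<Longrightarrow> Poly_Mapping.keys (E g) \<subseteq> B"
  using hom_in_carrier[OF E_hom] by simp

lemma E_mult: "g \<in> carrier G \<Longrightarrow> h \<in> carrier G \<Longrightarrow> E (g \<otimes> h) = E g + E h"
  using hom_mult[OF E_hom] by simp

lemma E_one: "E \<one> = 0"
  using group_hom.hom_one[OF E_group_hom] by simp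

lemma E_inv: "g \<in> carrier G \<Longrightarrow> E (inv g) = - E g"
  using group_hom.hom_inv[OF E_group_hom] E_keys by simp

lemma E_pow: "g \<in> carrier G \<Longrightarrow> E (g [^] (n::int)) = frag_cmul n (E g)"
  using group_hom.hom_int_pow[OF E_group_hom] E_keys by simp

lemma S_carrier: "s \<in> S \<Longrightarrow> s \<in> carrier G"
  by (simp add: S_def)

lemma S_closed:
  "\<one> \<in> S" "s \<in> S \<Longrightarrow> s' \<in> S \<Longrightarrow> s \<otimes> s' \<in> S" "s \<in> S \<Longrightarrow> inv s \<in> S"
  "g \<in> carrier G \<Longrightarrow> s \<in> S \<Longrightarrow> g \<otimes> s \<otimes> inv g \<in> S"
  "g \<in> carrier G \<Longrightarrow> h \<in> carrier G \<Longrightarrow> g \<otimes> h \<otimes> inv g \<otimes> inv h \<in> S"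
  by (auto simp: S_def E_mult E_inv E_one)

lemma p_closed: "s \<in> S \<Longrightarrow> p s \<in> carrier Q"
  using hom_in_carrier[OF p_hom] by simp

lemma p_mult: "s \<in> S \<Longrightarrow> s' \<in> S \<Longrightarrow> p (s \<otimes> s') = p s \<otimes>\<^bsub>Q\<^esub> p s'"
  using hom_mult[OF p_hom] by simp

lemma p_one: "p \<one> = \<one>\<^bsub>Q\<^esub>"
  using p_mult[of \<one> \<one>] p_closed[of \<one>] S_closed(1) by (metis Q.l_cancel_one' l_one one_closed)

lemma p_mult_inv: "s \<in> S \<Longrightarrow> p s \<otimes>\<^bsub>Q\<^esub> p (inv s) = \<one>\<^bsub>Q\<^esub>"
  by (simp add: p_mult[symmetric] S_closed S_carrier p_one)

section \<open>The commutator pairing with values in \<open>Q\<close>\<close>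

lemma commutator_value_closed:
  "g \<in> carrier G \<Longrightarrow> h \<in> carrier G \<Longrightarrow> commutator_value g h \<in> carrier Q"
  by (simp add: commutator_value_def p_closed S_closed)

text \<open>Writing [x, y] for the commutator, [ab, h] is the conjugate of [b, h] by a, times
  [a, h]. The conjugation is invisible to \<open>p\<close>, and the order of the factors is
  irrelevant in \<open>Q\<close>.\<close>

lemma commutator_value_mult_left:
  assumes "a \<in> carrier G" "b \<in> carrier G" "h \<in> carrier G"
  shows "commutator_value (a \<otimes> b) h = commutator_value a h \<otimes>\<^bsub>Q\<^esub> commutator_value b h"
proof -
  let ?c = "b \<otimes> h \<otimes> inv b \<otimes> inv h" and ?d = "a \<otimes> h \<otimes> inv a \<otimes> inv h"
  have "inv a \<otimes> (a \<otimes> u) = u" "inv h \<otimes> (h \<otimes> u) = u" if "u \<in> carrier G" for u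
    using assms that by (simp_all flip: m_assoc)
  then have "a \<otimes> b \<otimes> h \<otimes> inv (a \<otimes> b) \<otimes> inv h = (a \<otimes> ?c \<otimes> inv a) \<otimes> ?d"
    using assms by (simp add: inv_mult_group m_assoc)
  moreover have "p ((a \<otimes> ?c \<otimes> inv a) \<otimes> ?d) = p ?c \<otimes>\<^bsub>Q\<^esub> p ?d"
    using assms by (simp add: p_mult S_closed p_conj)
  ultimately show ?thesis
    using assms by (simp add: commutator_value_def Q.m_comm p_closed S_closed)
qed

text \<open>The commutator is a conjugate of \<open>s\<close> times the inverse of \<open>s\<close>,
  and \<open>p\<close> takes the same value on \<open>s\<close> and its conjugate.\<close>

lemma commutator_value_S:
  assumes "g \<in> carrier G" "s \<in> S"
  shows "commutator_value g s = \<one>\<^bsub>Q\<^esub>"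
  unfolding commutator_value_def using assms
  by (simp only: p_mult S_closed p_conj p_mult_inv)

lemma commutator_value_pow:
  assumes "t \<in> carrier G" "h \<in> carrier G"
  shows "commutator_value (t [^] (n::int)) h = commutator_value t h [^]\<^bsub>Q\<^esub> n"
proof (rule hom_int_pow[of "\<lambda>g. commutator_value g h"])
  show "(\<lambda>g. commutator_value g h) \<in> hom G Q"
    using assms by (intro homI) (simp_all add: commutator_value_closed commutator_value_mult_left)
qed (use assms in simp_all)

section \<open>Extending \<open>p\<close> along the support subgroups\<close>

lemma supp_subgroup_carrier: "g \<in> supp_subgroup T \<Longrightarrow> g \<in> carrier G"
  by (simp add: supp_subgroup_def)

lemma supp_subgroup_mult:
  "g \<in> supp_subgroup T \<Longrightarrow> h \<in> supp_subgroup T \<Longrightarrow> g \<otimes> h \<in> supp_subgroup T"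
  using keys_add[of "E g" "E h"] by (auto simp: supp_subgroup_def E_mult)

lemma supp_subgroup_pow:
  "g \<in> supp_subgroup T \<Longrightarrow> g [^] (n::int) \<in> supp_subgroup T"
  by (auto simp: supp_subgroup_def E_pow)

lemma S_supp_subgroup: "s \<in> S \<Longrightarrow> s \<in> supp_subgroup T"
  by (simp add: S_def supp_subgroup_def)

lemma supp_subgroup_empty: "supp_subgroup {} = S"
  by (auto simp: S_def supp_subgroup_def)

lemma quadratic_extension_empty: "quadratic_extension {} p (\<lambda>_ _. \<one>\<^bsub>Q\<^esub>)"
  by (simp add: quadratic_extension_def supp_subgroup_empty p_closed p_mult)

lemma supp_subgroup_insert_iff:
  "g \<in> supp_subgroup T \<longleftrightarrow> g \<in> supp_subgroup (insert x T) \<and> Poly_Mapping.lookup (E g) x = 0"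
  if "x \<notin> T"
  using that by (auto simp: supp_subgroup_def in_keys_iff)

text \<open>The coefficients at \<open>x\<close> form a nonzero subgroup of the integers. The
  element \<open>t\<close> realizes its least positive member, which divides the others by division
  with remainder.\<close>

lemma lookup_E_generator:
  assumes g0: "g0 \<in> supp_subgroup T" "Poly_Mapping.lookup (E g0) x \<noteq> 0"
  obtains t where "t \<in> supp_subgroup T" "Poly_Mapping.lookup (E t) x > 0"
    "\<And>g. g \<in> supp_subgroup T \<Longrightarrow> Poly_Mapping.lookup (E t) x dvd Poly_Mapping.lookup (E g) x"
proof -
  let ?e = "\<lambda>g. Poly_Mapping.lookup (E g) x"
  let ?P = "\<lambda>g. g \<in> supp_subgroup T \<and> ?e g > 0"
  \<comment> \<open>The exponent is the coefficient itself, so the new coefficient is its square,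
    positive whatever the sign.\<close>
  have "?P (g0 [^] (?e g0))"
    using g0 by (simp add: supp_subgroup_pow E_pow supp_subgroup_carrier) (metis not_real_square_gt_zero zero_less_mult_iff linorder_neqE)
  then obtain t where t: "?P t" and least: "\<And>g. ?P g \<Longrightarrow> nat (?e t) \<le> nat (?e g)"
    using ex_has_least_nat[of ?P _ "\<lambda>g. nat (?e g)"] by blast
  have "?e t dvd ?e g" if g: "g \<in> supp_subgroup T" for g
  proof -
    let ?h = "g \<otimes> t [^] (- (?e g div ?e t))"
    have h: "?h \<in> supp_subgroup T" using g t by (simp only: supp_subgroup_mult supp_subgroup_pow)
    have "?e ?h = ?e g - (?e g div ?e t) * ?e t"
      using supp_subgroup_carrier[OF g] supp_subgroup_carrier[of t T] t
      by (simp add: E_mult E_pow lookup_add)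
    then have "?e ?h = ?e g mod ?e t" by (simp add: minus_div_mult_eq_mod)
    moreover have "0 \<le> ?e g mod ?e t" "?e g mod ?e t < ?e t" using t by simp_all
    ultimately show ?thesis using least[of ?h] h by (cases "?e ?h = 0") (auto simp: dvd_eq_mod_eq_0)
  qed
  with t that show ?thesis by blast
qed

text \<open>
  The subgroup of \<open>insert x T\<close> is generated by the one of \<open>T\<close> and an element \<open>t\<close> of infinite order
  modulo it; every element is uniquely \<open>r t\<^sup>n\<close>, and ignoring \<open>t\<^sup>n\<close> extends \<open>\<phi>\<close>.
\<close>

lemma quadratic_extension_insert:
  assumes quad: "quadratic_extension T \<phi> \<beta>" and x: "x \<notin> T"
  shows "\<exists>\<phi> \<beta>. quadratic_extension (insert x T) \<phi> \<beta>"
proof (cases "\<exists>g\<in>supp_subgroup (insert x T). Poly_Mapping.lookup (E g) x \<noteq> 0")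
  case False
  then have "supp_subgroup (insert x T) = supp_subgroup T"
    using supp_subgroup_insert_iff[OF x] by blast
  with quad have "quadratic_extension (insert x T) \<phi> \<beta>"
    by (simp only: quadratic_extension_def)
  then show ?thesis by blast
next
  case True
  let ?H = "supp_subgroup T" and ?K = "supp_subgroup (insert x T)"
  let ?e = "\<lambda>g. Poly_Mapping.lookup (E g) x"
  from True obtain t where t: "t \<in> ?K" and d: "?e t > 0" and dvd: "\<And>g. g \<in> ?K \<Longrightarrow> ?e t dvd ?e g"
    using lookup_E_generator[of _ "insert x T" x] by metis
  have tc: "t \<in> carrier G" using t by (rule supp_subgroup_carrier)
  \<comment> \<open>\<open>t [^] n g\<close> carries the whole coefficient of \<open>g\<close> at
    \<open>x\<close>, and \<open>r g\<close> is what remains. Divisibility makes \<open>n\<close>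
    additive.\<close>
  define n where "n g = ?e g div ?e t" for g
  define r where "r g = g \<otimes> t [^] (- n g)" for g
  have n_mult: "n (g \<otimes> h) = n g + n h" if "g \<in> ?K" "h \<in> ?K" for g h
    using that[THEN supp_subgroup_carrier] dvd[OF that(1)]
    by (simp add: n_def E_mult lookup_add div_plus_div_distrib_dvd_left)
  have r: "r g \<in> ?H" if "g \<in> ?K" for g
  proof -
    have "r g \<in> ?K" unfolding r_def using that t by (intro supp_subgroup_mult supp_subgroup_pow)
    moreover have "?e (r g) = 0"
      using that[THEN supp_subgroup_carrier] tc dvd[OF that]
      by (simp add: r_def n_def E_mult E_pow lookup_add)
    ultimately show ?thesis using supp_subgroup_insert_iff[OF x] by blast
  qed
  have n_S: "n s = 0" and r_S: "r s = s" if "s \<in> S" for s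
    using that by (auto simp: S_def r_def n_def)
  \<comment> \<open>With g = r(g) t^n, moving t^n past r(h) costs the commutator of t^n and r(h).
    Conjugated by r(g), this is the factor \<open>z\<close>, and \<open>p\<close> does not see the
    conjugation.\<close>
  have r_mult: "\<exists>z\<in>S. r (g \<otimes> h) = z \<otimes> (r g \<otimes> r h) \<and> p z = commutator_value (t [^] n g) (r h)"
    if g: "g \<in> ?K" and h: "h \<in> ?K" for g h
  proof -
    let ?c = "t [^] n g \<otimes> r h \<otimes> inv (t [^] n g) \<otimes> inv (r h)"
    let ?z = "r g \<otimes> ?c \<otimes> inv (r g)"
    have c: "g \<in> carrier G" "h \<in> carrier G" "r g \<in> carrier G" "r h \<in> carrier G"
      using g h r supp_subgroup_carrier by blast+
    have cS: "?c \<in> S" using c tc by (intro S_closed) simp_all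
    have canc: "inv u \<otimes> (u \<otimes> v) = v" if "u \<in> carrier G" "v \<in> carrier G" for u v
      using that by (simp flip: m_assoc)
    have pow: "t [^] (- n g - n h) = t [^] (- n h) \<otimes> t [^] (- n g)"
      by (metis add.commute diff_conv_add_uminus int_pow_mult tc)
    have "r (g \<otimes> h) = g \<otimes> h \<otimes> t [^] (- n h) \<otimes> t [^] (- n g)"
      using c tc by (simp add: r_def n_mult[OF g h] pow m_assoc)
    also have "\<dots> = ?z \<otimes> (r g \<otimes> r h)"
      using c tc by (simp add: m_assoc canc) (simp add: r_def m_assoc canc int_pow_neg)
    finally have "r (g \<otimes> h) = ?z \<otimes> (r g \<otimes> r h)" .
    moreover have "?z \<in> S" using c cS by (simp only: S_closed)
    moreover have "p ?z = commutator_value (t [^] n g) (r h)"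
      unfolding commutator_value_def using c cS by (simp only: p_conj)
    ultimately show ?thesis by blast
  qed
  define \<phi>' where "\<phi>' g = \<phi> (r g)" for g
  \<comment> \<open>The second factor is the value of \<open>p\<close> at the correction
    \<open>z\<close> of \<open>r_mult\<close>; it is multiplicative in \<open>g\<close> because
    \<open>n\<close> is additive.\<close>
  define \<beta>' where "\<beta>' g h = \<beta> (r g) (r h) \<otimes>\<^bsub>Q\<^esub> commutator_value t (r h) [^]\<^bsub>Q\<^esub> n g" for g h
  note q = quad[unfolded quadratic_extension_def]
  have \<phi>_closed: "\<phi> g \<in> carrier Q" if "g \<in> ?H" for g using q that by blast
  have \<beta>_closed: "\<beta> g h \<in> carrier Q" if "g \<in> ?H" "h \<in> ?H" for g h using q that by blast
  have \<phi>_S: "\<phi> s = p s" if "s \<in> S" for s using q that by blast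
  have \<phi>_mult: "\<phi> (g \<otimes> h) = \<phi> g \<otimes>\<^bsub>Q\<^esub> \<phi> h \<otimes>\<^bsub>Q\<^esub> \<beta> g h" if "g \<in> ?H" "h \<in> ?H" for g h using q that by blast
  have \<beta>_mult: "\<beta> (g \<otimes> h) k = \<beta> g k \<otimes>\<^bsub>Q\<^esub> \<beta> h k" if "g \<in> ?H" "h \<in> ?H" "k \<in> ?H" for g h k
    using q that by blast
  have \<beta>_S: "\<beta> g s = \<one>\<^bsub>Q\<^esub>" "\<beta> s g = \<one>\<^bsub>Q\<^esub>" if "g \<in> ?H" "s \<in> S" for g s using q that by blast+
  have c_closed: "commutator_value t (r g) \<in> carrier Q" if "g \<in> ?K" for g
    using that tc r by (intro commutator_value_closed) (auto intro: supp_subgroup_carrier)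
  have "quadratic_extension (insert x T) \<phi>' \<beta>'"
    unfolding quadratic_extension_def
  proof (intro conjI ballI)
    fix g assume g: "g \<in> ?K"
    show "\<phi>' g \<in> carrier Q" using r[OF g] by (simp add: \<phi>'_def \<phi>_closed)
    show "\<beta>' g h \<in> carrier Q" if h: "h \<in> ?K" for h
      using r[OF g] r[OF h] c_closed[OF h] by (simp add: \<beta>'_def \<beta>_closed)
    show "\<phi>' (g \<otimes> h) = \<phi>' g \<otimes>\<^bsub>Q\<^esub> \<phi>' h \<otimes>\<^bsub>Q\<^esub> \<beta>' g h" if h: "h \<in> ?K" for h
    proof -
      obtain z where z: "z \<in> S" "r (g \<otimes> h) = z \<otimes> (r g \<otimes> r h)"
        "p z = commutator_value (t [^] n g) (r h)" using r_mult[OF g h] by blast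
      have "\<phi>' (g \<otimes> h) = p z \<otimes>\<^bsub>Q\<^esub> (\<phi> (r g) \<otimes>\<^bsub>Q\<^esub> \<phi> (r h) \<otimes>\<^bsub>Q\<^esub> \<beta> (r g) (r h))"
        using r[OF g] r[OF h] z(1)
        by (simp add: \<phi>'_def z(2) \<phi>_mult supp_subgroup_mult S_supp_subgroup \<phi>_S \<beta>_S p_closed \<phi>_closed \<beta>_closed)
      moreover have "p z = commutator_value t (r h) [^]\<^bsub>Q\<^esub> n g"
        using z(3) commutator_value_pow[OF tc supp_subgroup_carrier[OF r[OF h]]] by simp
      ultimately show ?thesis
        using r[OF g] r[OF h] c_closed[OF h]
        by (simp add: \<phi>'_def \<beta>'_def Q.m_ac \<phi>_closed \<beta>_closed)
    qed
    show "\<beta>' (g \<otimes> h) k = \<beta>' g k \<otimes>\<^bsub>Q\<^esub> \<beta>' h k" if h: "h \<in> ?K" and k: "k \<in> ?K" for h k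
    proof -
      \<comment> \<open>\<open>r\<close> fails to be multiplicative only by a factor in
        \<open>S\<close>, on which the old cocycle is trivial.\<close>
      obtain z where z: "z \<in> S" "r (g \<otimes> h) = z \<otimes> (r g \<otimes> r h)" using r_mult[OF g h] by blast
      have "\<beta> (r (g \<otimes> h)) (r k) = \<beta> (r g) (r k) \<otimes>\<^bsub>Q\<^esub> \<beta> (r h) (r k)"
        using r[OF g] r[OF h] r[OF k] z(1)
        by (simp add: z(2) \<beta>_mult supp_subgroup_mult S_supp_subgroup \<beta>_S \<beta>_closed)
      then show ?thesis
        using r[OF g] r[OF h] r[OF k] c_closed[OF k]
        by (simp add: \<beta>'_def n_mult[OF g h] Q.int_pow_mult Q.m_ac \<beta>_closed)
    qed
    \<comment> \<open>An element of \<open>S\<close> has \<open>n\<close> zero and trivial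
      commutator value with \<open>t\<close>, so the new factor disappears on either side.\<close>
    show "\<beta>' g s = \<one>\<^bsub>Q\<^esub>" "\<beta>' s g = \<one>\<^bsub>Q\<^esub>" if s: "s \<in> S" for s
      using r[OF g] s by (simp_all add: \<beta>'_def r_S n_S \<beta>_S commutator_value_S tc)
  qed (simp add: \<phi>'_def r_S \<phi>_S)
  then show ?thesis by blast
qed

lemma ex_quadratic_extension: "finite T \<Longrightarrow> \<exists>\<phi> \<beta>. quadratic_extension T \<phi> \<beta>"
proof (induction T rule: finite_induct)
  case empty
  show ?case using quadratic_extension_empty by blast
next
  case (insert x T)
  then show ?case using quadratic_extension_insert by blast
qed

section \<open>Group ring elements killed by \<open>E\<close> and by the quadratic
  extensions\<close>

lemma diff_closed_frag_extend_E_kernel: "diff_closed {u. frag_extend E u = 0}"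
  by (auto simp: diff_closed_def frag_extend_diff)

text \<open>
  A quadratic extension is only available on each of the subgroups supported in a finite set \<open>T\<close>, so
  vanishing is required for all sufficiently large \<open>T\<close>.
\<close>

definition quadratic_vanish :: "('a \<Rightarrow>\<^sub>0 int) set" where
  "quadratic_vanish = {u. Poly_Mapping.keys u \<subseteq> carrier G \<and>
     (\<exists>T0. finite T0 \<and> (\<forall>T \<phi> \<beta> \<Phi>. T0 \<subseteq> T \<longrightarrow> quadratic_extension T \<phi> \<beta> \<longrightarrow>
        \<Phi> \<in> hom (free_Abelian_group (carrier G)) Q \<longrightarrow>
        (\<forall>g\<in>supp_subgroup T. \<Phi> (frag_of g) = \<phi> g) \<longrightarrow> \<Phi> u = \<one>\<^bsub>Q\<^esub>))}"

lemma quadratic_vanishI: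
  assumes "Poly_Mapping.keys u \<subseteq> carrier G" "finite T0"
    and "\<And>T \<phi> \<beta> \<Phi>. T0 \<subseteq> T \<Longrightarrow> quadratic_extension T \<phi> \<beta> \<Longrightarrow>
        \<Phi> \<in> hom (free_Abelian_group (carrier G)) Q \<Longrightarrow>
        (\<And>g. g \<in> supp_subgroup T \<Longrightarrow> \<Phi> (frag_of g) = \<phi> g) \<Longrightarrow> \<Phi> u = \<one>\<^bsub>Q\<^esub>"
  shows "u \<in> quadratic_vanish"
  unfolding quadratic_vanish_def
proof (intro CollectI conjI exI[of _ T0] allI impI)
  fix T \<phi> \<beta> \<Phi>
  assume "T0 \<subseteq> T" "quadratic_extension T \<phi> \<beta>" "\<Phi> \<in> hom (free_Abelian_group (carrier G)) Q"
    "\<forall>g\<in>supp_subgroup T. \<Phi> (frag_of g) = \<phi> g"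
  then show "\<Phi> u = \<one>\<^bsub>Q\<^esub>" by (intro assms(3)[where \<phi> = \<phi> and \<beta> = \<beta>]) (assumption | erule bspec)+
qed (use assms(1,2) in simp_all)

lemma quadratic_vanishD:
  assumes "u \<in> quadratic_vanish"
  shows "Poly_Mapping.keys u \<subseteq> carrier G"
    and "\<exists>T0. finite T0 \<and> (\<forall>T \<phi> \<beta> \<Phi>. T0 \<subseteq> T \<longrightarrow> quadratic_extension T \<phi> \<beta> \<longrightarrow>
        \<Phi> \<in> hom (free_Abelian_group (carrier G)) Q \<longrightarrow>
        (\<forall>g\<in>supp_subgroup T. \<Phi> (frag_of g) = \<phi> g) \<longrightarrow> \<Phi> u = \<one>\<^bsub>Q\<^esub>)"
  using assms unfolding quadratic_vanish_def by simp_all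

lemma hom_free_Abelian_group_diff:
  assumes \<Phi>: "\<Phi> \<in> hom (free_Abelian_group (carrier G)) Q"
    and "Poly_Mapping.keys u \<subseteq> carrier G" "Poly_Mapping.keys v \<subseteq> carrier G"
  shows "\<Phi> (u - v) = \<Phi> u \<otimes>\<^bsub>Q\<^esub> inv\<^bsub>Q\<^esub> \<Phi> v"
proof -
  interpret h: group_hom "free_Abelian_group (carrier G)" Q \<Phi>
    using \<Phi> by (simp add: group_hom_def group_hom_axioms_def Q.is_group)
  have "\<Phi> (u + - v) = \<Phi> u \<otimes>\<^bsub>Q\<^esub> \<Phi> (- v)"
    using h.hom_mult[of u "- v"] assms by simp
  moreover have "\<Phi> (- v) = inv\<^bsub>Q\<^esub> \<Phi> v"
    using h.hom_inv[of v] assms by simp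
  ultimately show ?thesis by simp
qed

lemma diff_closed_quadratic_vanish: "diff_closed quadratic_vanish"
  unfolding diff_closed_def
proof (intro conjI ballI)
  show "0 \<in> quadratic_vanish"
  proof (rule quadratic_vanishI[of _ "{}"])
    fix \<Phi> assume "\<Phi> \<in> hom (free_Abelian_group (carrier G)) Q"
    then show "\<Phi> 0 = \<one>\<^bsub>Q\<^esub>"
      using hom_one[OF _ group_free_Abelian_group Q.is_group] by fastforce
  qed auto
next
  fix u v assume uv: "u \<in> quadratic_vanish" "v \<in> quadratic_vanish"
  note keys = uv[THEN quadratic_vanishD(1)]
  obtain T1 T2 where fin: "finite T1" "finite T2"
    and T1: "\<forall>T \<phi> \<beta> \<Phi>. T1 \<subseteq> T \<longrightarrow> quadratic_extension T \<phi> \<beta> \<longrightarrow>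
        \<Phi> \<in> hom (free_Abelian_group (carrier G)) Q \<longrightarrow>
        (\<forall>g\<in>supp_subgroup T. \<Phi> (frag_of g) = \<phi> g) \<longrightarrow> \<Phi> u = \<one>\<^bsub>Q\<^esub>"
    and T2: "\<forall>T \<phi> \<beta> \<Phi>. T2 \<subseteq> T \<longrightarrow> quadratic_extension T \<phi> \<beta> \<longrightarrow>
        \<Phi> \<in> hom (free_Abelian_group (carrier G)) Q \<longrightarrow>
        (\<forall>g\<in>supp_subgroup T. \<Phi> (frag_of g) = \<phi> g) \<longrightarrow> \<Phi> v = \<one>\<^bsub>Q\<^esub>"
    using uv[THEN quadratic_vanishD(2)] by (elim exE conjE) (rule that)
  show "u - v \<in> quadratic_vanish"
  \<comment> \<open>Above the union of the two thresholds both \<open>u\<close> and \<open>v\<close>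
    are sent to the identity.\<close>
  proof (rule quadratic_vanishI[of _ "T1 \<union> T2"])
    show "Poly_Mapping.keys (u - v) \<subseteq> carrier G"
      using keys_diff[of u v] keys by blast
    fix T \<phi> \<beta> \<Phi> assume T: "T1 \<union> T2 \<subseteq> T" and q: "quadratic_extension T \<phi> \<beta>"
      and \<Phi>: "\<Phi> \<in> hom (free_Abelian_group (carrier G)) Q"
      and eq: "\<And>g. g \<in> supp_subgroup T \<Longrightarrow> \<Phi> (frag_of g) = \<phi> g"
    have "\<Phi> u = \<one>\<^bsub>Q\<^esub>" "\<Phi> v = \<one>\<^bsub>Q\<^esub>"
      using T1[rule_format, OF _ q \<Phi> eq] T2[rule_format, OF _ q \<Phi> eq] T by auto
    then show "\<Phi> (u - v) = \<one>\<^bsub>Q\<^esub>" by (simp add: hom_free_Abelian_group_diff[OF \<Phi> keys])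
  qed (use fin in simp)
qed

lemma keys_add_carrier:
  "Poly_Mapping.keys u \<subseteq> carrier G \<Longrightarrow> Poly_Mapping.keys v \<subseteq> carrier G \<Longrightarrow>
   Poly_Mapping.keys (u + v) \<subseteq> carrier G"
  using keys_add[of u v] by blast

text \<open>With \<open>u\<close> and \<open>v\<close> collecting the positive and the negative
  terms of an expansion, the check becomes an equation of products in \<open>Q\<close>, free of
  inverses.\<close>

lemma quadratic_vanish_diffI:
  assumes u: "Poly_Mapping.keys u \<subseteq> carrier G" and v: "Poly_Mapping.keys v \<subseteq> carrier G" and T0: "finite T0"
    and eq: "\<And>T \<phi> \<beta> \<Phi>. T0 \<subseteq> T \<Longrightarrow> quadratic_extension T \<phi> \<beta> \<Longrightarrow>
        \<Phi> \<in> hom (free_Abelian_group (carrier G)) Q \<Longrightarrow>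
        (\<And>g. g \<in> supp_subgroup T \<Longrightarrow> \<Phi> (frag_of g) = \<phi> g) \<Longrightarrow> \<Phi> u = \<Phi> v"
  shows "u - v \<in> quadratic_vanish"
proof (rule quadratic_vanishI[OF _ T0])
  show "Poly_Mapping.keys (u - v) \<subseteq> carrier G" using keys_diff[of u v] u v by blast
  fix T \<phi> \<beta> \<Phi> assume *: "T0 \<subseteq> T" "quadratic_extension T \<phi> \<beta>"
      "\<Phi> \<in> hom (free_Abelian_group (carrier G)) Q"
      "\<And>g. g \<in> supp_subgroup T \<Longrightarrow> \<Phi> (frag_of g) = \<phi> g"
  have "\<Phi> v \<in> carrier Q" using hom_in_carrier[OF *(3)] v by simp
  then show "\<Phi> (u - v) = \<one>\<^bsub>Q\<^esub>"
    by (simp add: hom_free_Abelian_group_diff[OF *(3) u v] eq[OF *])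
qed

lemma quadratic_extensionD:
  assumes "quadratic_extension T \<phi> \<beta>"
  shows "\<And>g. g \<in> supp_subgroup T \<Longrightarrow> \<phi> g \<in> carrier Q"
    and "\<And>g h. g \<in> supp_subgroup T \<Longrightarrow> h \<in> supp_subgroup T \<Longrightarrow> \<beta> g h \<in> carrier Q"
    and "\<And>s. s \<in> S \<Longrightarrow> \<phi> s = p s"
    and "\<And>g h. g \<in> supp_subgroup T \<Longrightarrow> h \<in> supp_subgroup T \<Longrightarrow>
      \<phi> (g \<otimes> h) = \<phi> g \<otimes>\<^bsub>Q\<^esub> \<phi> h \<otimes>\<^bsub>Q\<^esub> \<beta> g h"
    and "\<And>g h k. g \<in> supp_subgroup T \<Longrightarrow> h \<in> supp_subgroup T \<Longrightarrow> k \<in> supp_subgroup T \<Longrightarrow>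
      \<beta> (g \<otimes> h) k = \<beta> g k \<otimes>\<^bsub>Q\<^esub> \<beta> h k"
    and "\<And>g s. g \<in> supp_subgroup T \<Longrightarrow> s \<in> S \<Longrightarrow> \<beta> g s = \<one>\<^bsub>Q\<^esub>"
  using assms unfolding quadratic_extension_def by blast+

text \<open>The value at (g - 1)(s - 1) is \<beta>(g, s), because \<phi> is trivial at the identity;
  and \<beta>(g, s) is trivial for \<open>s\<close> in \<open>S\<close>.\<close>

lemma quadratic_vanish_product:
  assumes g: "g \<in> carrier G" and s: "s \<in> S"
  shows "(frag_of g - frag_of \<one>) \<otimes>\<^bsub>group_ring G\<^esub> (frag_of s - frag_of \<one>) \<in> quadratic_vanish"
proof -
  note sc = S_carrier[OF s]
  let ?u = "frag_of (g \<otimes> s) + frag_of \<one>" and ?v = "frag_of g + frag_of s"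
  have "?u - ?v \<in> quadratic_vanish"
  \<comment> \<open>\<open>S\<close> lies in every support subgroup, so only the support of
    \<open>E g\<close> has to be prescribed.\<close>
  proof (rule quadratic_vanish_diffI[where ?T0.0 = "Poly_Mapping.keys (E g)"])
    fix T \<phi> \<beta> \<Phi> assume T: "Poly_Mapping.keys (E g) \<subseteq> T" and q: "quadratic_extension T \<phi> \<beta>"
      and \<Phi>: "\<Phi> \<in> hom (free_Abelian_group (carrier G)) Q"
      and \<Phi>_eq: "\<And>g. g \<in> supp_subgroup T \<Longrightarrow> \<Phi> (frag_of g) = \<phi> g"
    have H: "g \<in> supp_subgroup T" "s \<in> supp_subgroup T" "\<one> \<in> supp_subgroup T"
      using T g s S_supp_subgroup S_closed(1) by (auto simp: supp_subgroup_def)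
    have "\<Phi> ?u = \<Phi> (frag_of (g \<otimes> s)) \<otimes>\<^bsub>Q\<^esub> \<Phi> (frag_of \<one>)"
      using hom_mult[OF \<Phi>, of "frag_of (g \<otimes> s)" "frag_of \<one>"] g sc by simp
    moreover have "\<Phi> ?v = \<Phi> (frag_of g) \<otimes>\<^bsub>Q\<^esub> \<Phi> (frag_of s)"
      using hom_mult[OF \<Phi>, of "frag_of g" "frag_of s"] g sc by simp
    ultimately show "\<Phi> ?u = \<Phi> ?v"
      using H s S_closed(1)
      by (simp add: \<Phi>_eq supp_subgroup_mult quadratic_extensionD[OF q] p_one p_closed)
  qed (use g sc in \<open>simp_all add: keys_add_carrier\<close>)
  moreover have "(frag_of g - frag_of \<one>) \<otimes>\<^bsub>group_ring G\<^esub> (frag_of s - frag_of \<one>) = ?u - ?v"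
    using g sc
    by (simp add: group_ring_mult_diff_left group_ring_mult_diff_right group_ring_mult_frag_of)
  ultimately show ?thesis by simp
qed

text \<open>Since (g - 1)(h - 1) = (gh - 1) - (g - 1) - (h - 1), the value is \<beta>(gh, k) divided
  by \<beta>(g, k) and \<beta>(h, k), which is trivial by multiplicativity in the first
  argument.\<close>

lemma quadratic_vanish_triple_product:
  assumes c: "g \<in> carrier G" "h \<in> carrier G" "k \<in> carrier G"
  shows "(frag_of g - frag_of \<one>) \<otimes>\<^bsub>group_ring G\<^esub> (frag_of h - frag_of \<one>)
    \<otimes>\<^bsub>group_ring G\<^esub> (frag_of k - frag_of \<one>) \<in> quadratic_vanish"
proof -
  let ?u = "frag_of (g \<otimes> h \<otimes> k) + (frag_of g + (frag_of h + frag_of k))"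
  let ?v = "frag_of (g \<otimes> h) + (frag_of (g \<otimes> k) + (frag_of (h \<otimes> k) + frag_of \<one>))"
  have "?u - ?v \<in> quadratic_vanish"
  proof (rule quadratic_vanish_diffI[where ?T0.0 =
      "Poly_Mapping.keys (E g) \<union> Poly_Mapping.keys (E h) \<union> Poly_Mapping.keys (E k)"])
    fix T \<phi> \<beta> \<Phi>
    assume T: "Poly_Mapping.keys (E g) \<union> Poly_Mapping.keys (E h) \<union> Poly_Mapping.keys (E k) \<subseteq> T"
      and q: "quadratic_extension T \<phi> \<beta>"
      and \<Phi>: "\<Phi> \<in> hom (free_Abelian_group (carrier G)) Q"
      and \<Phi>_eq: "\<And>g. g \<in> supp_subgroup T \<Longrightarrow> \<Phi> (frag_of g) = \<phi> g"
    have H: "g \<in> supp_subgroup T" "h \<in> supp_subgroup T" "k \<in> supp_subgroup T"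
      "\<one> \<in> supp_subgroup T"
      using T c S_supp_subgroup S_closed(1) by (auto simp: supp_subgroup_def)
    have add: "\<Phi> (frag_of a + w) = \<Phi> (frag_of a) \<otimes>\<^bsub>Q\<^esub> \<Phi> w"
      if "a \<in> carrier G" "Poly_Mapping.keys w \<subseteq> carrier G" for a w
      using hom_mult[OF \<Phi>, of "frag_of a" w] that by simp
    have "\<Phi> ?u = \<Phi> (frag_of (g \<otimes> h \<otimes> k)) \<otimes>\<^bsub>Q\<^esub> (\<Phi> (frag_of g) \<otimes>\<^bsub>Q\<^esub>
        (\<Phi> (frag_of h) \<otimes>\<^bsub>Q\<^esub> \<Phi> (frag_of k)))"
      using c by (simp add: add keys_add_carrier)
    moreover have "\<Phi> ?v = \<Phi> (frag_of (g \<otimes> h)) \<otimes>\<^bsub>Q\<^esub> (\<Phi> (frag_of (g \<otimes> k)) \<otimes>\<^bsub>Q\<^esub>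
        (\<Phi> (frag_of (h \<otimes> k)) \<otimes>\<^bsub>Q\<^esub> \<Phi> (frag_of \<one>)))"
      using c by (simp add: add keys_add_carrier)
    ultimately show "\<Phi> ?u = \<Phi> ?v"
      using H quadratic_extensionD(3)[OF q S_closed(1)]
      by (simp add: \<Phi>_eq supp_subgroup_mult quadratic_extensionD(1,2,4,5)[OF q] p_one Q.m_ac)
  qed (use c in \<open>simp_all add: keys_add_carrier\<close>)
  moreover have "(frag_of g - frag_of \<one>) \<otimes>\<^bsub>group_ring G\<^esub> (frag_of h - frag_of \<one>)
      \<otimes>\<^bsub>group_ring G\<^esub> (frag_of k - frag_of \<one>) = ?u - ?v"
    using c
    by (simp add: group_ring_mult_diff_left group_ring_mult_diff_right group_ring_mult_frag_of)
  ultimately show ?thesis by simp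
qed

text \<open>Every admissible \<Phi> takes the value \<open>p s\<close> at s - 1. The direction from
  left to right also requires one admissible \<Phi> to exist, which is where
  \<open>ex_quadratic_extension\<close> enters.\<close>

lemma quadratic_vanish_S:
  assumes s: "s \<in> S"
  shows "frag_of s - frag_of \<one> \<in> quadratic_vanish \<longleftrightarrow> p s = \<one>\<^bsub>Q\<^esub>"
proof -
  have \<Phi>_eq: "\<Phi> (frag_of s - frag_of \<one>) = p s"
    if "quadratic_extension T \<phi> \<beta>" "\<Phi> \<in> hom (free_Abelian_group (carrier G)) Q"
      "\<And>g. g \<in> supp_subgroup T \<Longrightarrow> \<Phi> (frag_of g) = \<phi> g" for T \<phi> \<beta> \<Phi>
    using that(3)[OF S_supp_subgroup] quadratic_extensionD(3)[OF that(1)] S_carrier[OF s] s S_closed(1)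
    by (simp add: hom_free_Abelian_group_diff[OF that(2)] p_one p_closed)
  show ?thesis
  proof
    assume "p s = \<one>\<^bsub>Q\<^esub>"
    then show "frag_of s - frag_of \<one> \<in> quadratic_vanish"
      using keys_diff[of "frag_of s" "frag_of \<one>"] S_carrier[OF s] \<Phi>_eq
      by (intro quadratic_vanishI[of _ "{}"]) auto
  next
    assume "frag_of s - frag_of \<one> \<in> quadratic_vanish"
    from quadratic_vanishD(2)[OF this] obtain T where T: "finite T"
      and van: "\<forall>T' \<phi> \<beta> \<Phi>. T \<subseteq> T' \<longrightarrow> quadratic_extension T' \<phi> \<beta> \<longrightarrow>
        \<Phi> \<in> hom (free_Abelian_group (carrier G)) Q \<longrightarrow>
        (\<forall>g\<in>supp_subgroup T'. \<Phi> (frag_of g) = \<phi> g) \<longrightarrow> \<Phi> (frag_of s - frag_of \<one>) = \<one>\<^bsub>Q\<^esub>"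
      by (elim exE conjE) (rule that)
    obtain \<phi> \<beta> where q: "quadratic_extension T \<phi> \<beta>" using ex_quadratic_extension[OF T] by blast
    \<comment> \<open>The identity is a default value outside the support subgroup; it makes
      \<open>?f\<close> total on \<open>G\<close>, so that it extends additively to the group
      ring.\<close>
    let ?f = "\<lambda>g. if g \<in> supp_subgroup T then \<phi> g else \<one>\<^bsub>Q\<^esub>"
    have "?f ` carrier G \<subseteq> carrier Q" using quadratic_extensionD(1)[OF q] by auto
    then obtain \<Phi> where \<Phi>: "\<Phi> \<in> hom (free_Abelian_group (carrier G)) Q"
      and "\<And>g. g \<in> carrier G \<Longrightarrow> \<Phi> (frag_of g) = ?f g"
      using Q.free_Abelian_group_universal by blast
    then have "\<And>g. g \<in> supp_subgroup T \<Longrightarrow> \<Phi> (frag_of g) = \<phi> g"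
      using supp_subgroup_carrier by simp
    from van[rule_format, OF subset_refl q \<Phi> this] \<Phi>_eq[OF q \<Phi> this] show "p s = \<one>\<^bsub>Q\<^esub>" by simp
  qed
qed

text \<open>All three summands lie in one additive subgroup, cut out by \<open>E\<close> and by the
  quadratic extensions. The first condition puts \<open>w\<close> in \<open>S\<close>, and on
  \<open>S\<close> the second one reads off \<open>p w\<close>.\<close>

lemma one_plus_inter_subset:
  assumes N: "N \<subseteq> S" "\<And>n. n \<in> N \<Longrightarrow> p n = \<one>\<^bsub>Q\<^esub>"
    and w: "w \<in> one_plus_inter G (augmentation_power G 3 <+>\<^bsub>group_ring G\<^esub>
      additive_product (group_ring G) (\<Delta> G) (\<Delta> (G\<lparr>carrier := S\<rparr>)) <+>\<^bsub>group_ring G\<^esub>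
      \<Delta> (G\<lparr>carrier := N\<rparr>))"
  shows "w \<in> S \<and> p w = \<one>\<^bsub>Q\<^esub>"
proof -
  let ?M = "{u. frag_extend E u = 0} \<inter> quadratic_vanish"
  have M: "diff_closed ?M"
    by (intro diff_closed_Int diff_closed_frag_extend_E_kernel diff_closed_quadratic_vanish)
  have wc: "w \<in> carrier G" using w by (simp add: one_plus_inter_def)
  \<comment> \<open>The additive extension of \<open>E\<close> kills (g - 1)(h - 1) already, because
    \<open>E\<close> is a homomorphism.\<close>
  have power: "augmentation_power G 3 \<subseteq> ?M"
    using quadratic_vanish_triple_product
    by (intro augmentation_power_3_subset[OF M])
      (simp add: group_ring_mult_diff_left group_ring_mult_diff_right group_ring_mult_frag_of
        frag_extend_diff E_mult E_one)
  \<comment> \<open>\<open>G\<close> appears as its own carrier update to fit the form of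
    \<open>augmentation_ideal_product_subset\<close>.\<close>
  have product: "additive_product (group_ring G) (\<Delta> (G\<lparr>carrier := carrier G\<rparr>)) (\<Delta> (G\<lparr>carrier := S\<rparr>)) \<subseteq> ?M"
    using quadratic_vanish_product
    by (intro augmentation_ideal_product_subset[OF M])
      (auto simp add: S_carrier group_ring_mult_diff_left group_ring_mult_diff_right
        group_ring_mult_frag_of frag_extend_diff E_mult E_one)
  have single: "\<Delta> (G\<lparr>carrier := N\<rparr>) \<subseteq> ?M"
  proof (rule augmentation_ideal_subset[OF M])
    fix n assume n: "n \<in> N"
    then have "E n = 0" using N(1) by (auto simp: S_def)
    then show "frag_of n - frag_of \<one> \<in> ?M"
      using n N quadratic_vanish_S by (auto simp: frag_extend_diff E_one)
  qed
  have "frag_of w - frag_of \<one> \<in> augmentation_power G 3 <+>\<^bsub>group_ring G\<^esub>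
      additive_product (group_ring G) (\<Delta> G) (\<Delta> (G\<lparr>carrier := S\<rparr>)) <+>\<^bsub>group_ring G\<^esub>
      \<Delta> (G\<lparr>carrier := N\<rparr>)"
    using w wc by (simp add: one_plus_inter_def group_ring_minus)
  then obtain a b c where abc: "a \<in> augmentation_power G 3"
    "b \<in> additive_product (group_ring G) (\<Delta> G) (\<Delta> (G\<lparr>carrier := S\<rparr>))" "c \<in> \<Delta> (G\<lparr>carrier := N\<rparr>)"
    "frag_of w - frag_of \<one> = a + b + c"
    by (auto simp: set_add_def set_mult_def)
  have "a \<in> ?M" "b \<in> ?M" "c \<in> ?M"
    using subsetD[OF power abc(1)] subsetD[OF product] subsetD[OF single abc(3)] abc(2) by simp_all
  then have "frag_of w - frag_of \<one> \<in> ?M"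
    unfolding abc(4) by (intro diff_closedD(4)[OF M])
  moreover from this have "w \<in> S"
    using wc by (simp add: S_def frag_extend_diff E_one)
  ultimately show ?thesis using quadratic_vanish_S by blast
qed

end

section \<open>The abelianization of a free group\<close>

lemma word_value_hom:
  assumes "group G" "group H" "h \<in> hom G H" "fst ` set w \<subseteq> B" "B \<subseteq> carrier G"
    "\<And>b. b \<in> B \<Longrightarrow> h b = f b"
  shows "h (word_value G (\<lambda>b. b) w) = word_value H f w"
proof -
  interpret h: group_hom G H h using assms by (simp add: group_hom_def group_hom_axioms_def)
  show ?thesis using assms(4)
  proof (induction w)
    case (Cons l w)
    obtain b e where l: "l = (b, e)" by (cases l)
    have w: "fst ` set w \<subseteq> B" and b: "b \<in> carrier G" "h b = f b"
      using Cons.prems assms(5,6) l by auto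
    have id: "(\<lambda>b. b) \<in> B \<rightarrow> carrier G" using assms(5) by auto
    have "word_value G (\<lambda>b. b) w \<in> carrier G"
      by (rule group.word_value_closed[OF assms(1) id w])
    then show ?case using Cons.IH[OF w] b l by simp
  qed simp
qed

text \<open>Each element is the value of a word in the basis, and homomorphisms commute with the
  evaluation of words.\<close>

lemma hom_eq_on_free_basis:
  assumes "group G" "group H" "free_basis G B" "h \<in> hom G H" "h' \<in> hom G H"
    "\<And>b. b \<in> B \<Longrightarrow> h b = h' b" "g \<in> carrier G"
  shows "h g = h' g"
proof -
  have B: "B \<subseteq> carrier G" and "g \<in> word_value G (\<lambda>b. b) ` reduced_words B"
    using assms(3,7) by (auto simp: free_basis_def bij_betw_def)
  then obtain w where w: "fst ` set w \<subseteq> B" "g = word_value G (\<lambda>b. b) w"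
    by (auto simp: reduced_words_def)
  show ?thesis
    using word_value_hom[OF assms(1,2,4) w(1) B, of h'] word_value_hom[OF assms(1,2,5) w(1) B, of h']
      assms(6) w(2) by simp
qed

text \<open>The abelianization factors through \<open>E\<close>, because both agree on the basis.\<close>

lemma free_group_derived_kernel:
  fixes F :: "('a, 'm) monoid_scheme"
  assumes "free_group F"
  obtains B :: "'a set" and E where "E \<in> hom F (free_Abelian_group B)"
    "\<And>g. g \<in> carrier F \<Longrightarrow> E g = 0 \<longleftrightarrow> g \<in> derived F (carrier F)"
proof -
  interpret free_group F by fact
  obtain B where B: "free_basis F B" using ex_free_basis by blast
  have "frag_of \<in> B \<rightarrow> carrier (free_Abelian_group B)" by auto
  from free_basis_universal[OF is_group group_free_Abelian_group B this]
  obtain E where E: "E \<in> hom F (free_Abelian_group B)" "\<And>b. b \<in> B \<Longrightarrow> E b = frag_of b" by blast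
  interpret E: group_hom F "free_Abelian_group B" E
    using E by (simp add: group_hom_def group_hom_axioms_def is_group)
  let ?D = "derived F (carrier F)"
  interpret D: normal ?D F
    by (rule derived_is_normal[OF normal_self])
  interpret A: comm_group "F Mod ?D" by (rule derived_quot_is_comm_group)
  have proj: "(\<lambda>g. ?D #>\<^bsub>F\<^esub> g) \<in> hom F (F Mod ?D)" by (rule D.r_coset_hom_Mod)
  have Bc: "B \<subseteq> carrier F" using B by (simp add: free_basis_def)
  then have "(\<lambda>g. ?D #>\<^bsub>F\<^esub> g) ` B \<subseteq> carrier (F Mod ?D)"
    using hom_in_carrier[OF proj] by blast
  \<comment> \<open>\<open>q\<close> leads back from the free abelian group on \<open>B\<close> to
    the abelianization of \<open>F\<close>; composed with \<open>E\<close> it is the projection,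
    since both agree on \<open>B\<close>.\<close>
  then obtain q where q: "q \<in> hom (free_Abelian_group B) (F Mod ?D)"
      "\<And>b. b \<in> B \<Longrightarrow> q (frag_of b) = ?D #>\<^bsub>F\<^esub> b"
    by (rule A.free_Abelian_group_universal) (rule that)
  have q_E_hom: "(\<lambda>g. q (E g)) \<in> hom F (F Mod ?D)"
    using Group.hom_compose[OF E(1) q(1)] by (simp add: comp_def)
  have q_E: "q (E g) = ?D #>\<^bsub>F\<^esub> g" if "g \<in> carrier F" for g
  proof (rule hom_eq_on_free_basis[OF is_group A.is_group B q_E_hom proj _ that])
    show "q (E b) = ?D #>\<^bsub>F\<^esub> b" if "b \<in> B" for b
      by (simp only: E(2)[OF that] q(2)[OF that])
  qed
  have "E g = 0 \<longleftrightarrow> g \<in> ?D" if g: "g \<in> carrier F" for g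
  proof
    \<comment> \<open>The coset of \<open>g\<close> is then \<open>q 0\<close>, the trivial
      coset.\<close>
    assume "E g = 0"
    then have "?D #>\<^bsub>F\<^esub> g = ?D"
      using q_E[OF g] hom_one[OF q(1) group_free_Abelian_group A.is_group] by simp
    then show "g \<in> ?D" using coset_join1 g D.subgroup_axioms by blast
  next
    \<comment> \<open>The target is commutative, so the kernel of \<open>E\<close> is a subgroup
      containing all commutators.\<close>
    have "?D \<subseteq> {g \<in> carrier F. E g = 0}"
    proof -
      have "subgroup {g \<in> carrier F. E g = 0} F"
        using E.subgroup_kernel by (simp add: kernel_def)
      moreover have "derived_set F (carrier F) \<subseteq> {g \<in> carrier F. E g = 0}"
        using hom_in_carrier[OF E(1)] by auto
      ultimately show ?thesis unfolding derived_def by (rule generate_subgroup_incl[rotated])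
    qed
    then show "g \<in> ?D \<Longrightarrow> E g = 0" by blast
  qed
  with E(1) show ?thesis by (rule that)
qed

section \<open>Commutator subgroups of normal subgroups\<close>

text \<open>A generating commutator is a conjugate of \<open>s\<close> times the inverse of
  \<open>s\<close>, and \<open>S\<close> is normal.\<close>

lemma (in group) commutator_subgroup_subset:
  assumes R: "R \<lhd> G" and S: "S \<lhd> G"
  shows "commutator_subgroup G R S \<subseteq> S"
proof -
  interpret R: normal R G by fact
  interpret S: normal S G by fact
  show ?thesis unfolding commutator_subgroup_def
  proof (rule generate_subgroup_incl[OF _ S.subgroup_axioms], safe)
    fix r s assume "r \<in> R" "s \<in> S"
    then show "r \<otimes> s \<otimes> inv r \<otimes> inv s \<in> S"
      using S.inv_op_closed2 R.mem_carrier by simp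
  qed
qed

lemma (in group) commutator_in_commutator_subgroup:
  "a \<in> A \<Longrightarrow> b \<in> B \<Longrightarrow> a \<otimes> b \<otimes> inv a \<otimes> inv b \<in> commutator_subgroup G A B"
  unfolding commutator_subgroup_def by (rule generate.incl) blast

lemma (in group) subgroup_commutator_subgroup:
  assumes "A \<subseteq> carrier G" "B \<subseteq> carrier G"
  shows "subgroup (commutator_subgroup G A B) G"
  unfolding commutator_subgroup_def using assms
  by (intro generate_is_subgroup) (auto dest!: subsetD)

section \<open>The intersection theorem\<close>

theorem proposition3p1:
  fixes F :: "('a, 'm) monoid_scheme" and R :: "'a set"
  assumes "free_group F" and "R \<lhd> F"
  shows "one_plus_inter (F\<lparr>carrier := R\<rparr>)
           (augmentation_power (F\<lparr>carrier := R\<rparr>) 3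
              <+>\<^bsub>group_ring (F\<lparr>carrier := R\<rparr>)\<^esub>
            additive_product (group_ring (F\<lparr>carrier := R\<rparr>))
              (\<Delta> (F\<lparr>carrier := R\<rparr>)) (\<Delta> (F\<lparr>carrier := R \<inter> derived F (carrier F)\<rparr>))
              <+>\<^bsub>group_ring (F\<lparr>carrier := R\<rparr>)\<^esub>
            \<Delta> (F\<lparr>carrier := commutator_subgroup F R (R \<inter> derived F (carrier F))\<rparr>))
         = commutator_subgroup F R (R \<inter> derived F (carrier F))"
proof -
  interpret F: free_group F by fact
  interpret R: normal R F by fact
  let ?G = "F\<lparr>carrier := R\<rparr>" and ?S = "R \<inter> derived F (carrier F)"
  let ?N = "commutator_subgroup F R ?S"
  have S_normal: "?S \<lhd> F"
    using F.normal_subgroup_intersect[OF assms(2) F.derived_is_normal[OF F.normal_self]] .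
  interpret S: normal ?S F by (rule S_normal)
  interpret G: group ?G by (rule R.subgroup_is_group[OF F.is_group])
  interpret SG: group "F\<lparr>carrier := ?S\<rparr>" by (rule S.subgroup_is_group[OF F.is_group])
  have N_S: "?N \<subseteq> ?S"
    by (rule F.commutator_subgroup_subset[OF assms(2) S_normal])
  have N_sub: "subgroup ?N F"
    by (rule F.subgroup_commutator_subgroup[OF R.subset S.subset])
  interpret N: subgroup ?N F by (rule N_sub)
  have comm: "r \<otimes>\<^bsub>F\<^esub> s \<otimes>\<^bsub>F\<^esub> inv\<^bsub>F\<^esub> r \<otimes>\<^bsub>F\<^esub> inv\<^bsub>F\<^esub> s \<in> ?N" if "r \<in> R" "s \<in> ?S" for r s
    using F.commutator_in_commutator_subgroup[OF that] .
  have coset_eq: "?N #>\<^bsub>F\<^esub> a = ?N #>\<^bsub>F\<^esub> b"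
    if "a \<otimes>\<^bsub>F\<^esub> inv\<^bsub>F\<^esub> b \<in> ?N" "a \<in> carrier F" "b \<in> carrier F" for a b
    using F.repr_independence[OF N.rcos_module_rev[OF F.is_group that(3,2,1)] that(3) N_sub] by simp
  have inv_G: "inv\<^bsub>?G\<^esub> r = inv\<^bsub>F\<^esub> r" if "r \<in> R" for r
    using F.m_inv_consistent[OF R.subgroup_axioms that] by simp
  have inv_S: "inv\<^bsub>F\<lparr>carrier := ?S\<rparr>\<^esub> s = inv\<^bsub>F\<^esub> s" if "s \<in> ?S" for s
    using F.m_inv_consistent[OF S.subgroup_axioms that] by simp
  \<comment> \<open>The conjugate of n by s is [s, n] n; here s lies in R and n in
    \<open>?S\<close>, so the commutator is one of the generators of \<open>?N\<close>.\<close>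
  have N_normal: "?N \<lhd> F\<lparr>carrier := ?S\<rparr>"
    unfolding SG.normal_inv_iff
  proof (intro conjI ballI)
    show "subgroup ?N (F\<lparr>carrier := ?S\<rparr>)"
      by (rule F.subgroup_incl[OF N_sub S.subgroup_axioms N_S])
    fix s n assume s: "s \<in> carrier (F\<lparr>carrier := ?S\<rparr>)" and n: "n \<in> ?N"
    have c: "s \<in> ?S" "n \<in> ?S" "s \<in> carrier F" "n \<in> carrier F" using s n N_S S.subset by auto
    have "s \<otimes>\<^bsub>F\<^esub> n \<otimes>\<^bsub>F\<^esub> inv\<^bsub>F\<^esub> s = (s \<otimes>\<^bsub>F\<^esub> n \<otimes>\<^bsub>F\<^esub> inv\<^bsub>F\<^esub> s \<otimes>\<^bsub>F\<^esub> inv\<^bsub>F\<^esub> n) \<otimes>\<^bsub>F\<^esub> n"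
      using c by (simp add: F.m_assoc)
    also have "\<dots> \<in> ?N" using c by (intro N.m_closed[OF comm n]) auto
    finally show "s \<otimes>\<^bsub>F\<lparr>carrier := ?S\<rparr>\<^esub> n \<otimes>\<^bsub>F\<lparr>carrier := ?S\<rparr>\<^esub> inv\<^bsub>F\<lparr>carrier := ?S\<rparr>\<^esub> s \<in> ?N"
      using inv_S[OF c(1)] by simp
  qed
  interpret NS: normal ?N "F\<lparr>carrier := ?S\<rparr>" by (rule N_normal)
  let ?Q = "F\<lparr>carrier := ?S\<rparr> Mod ?N" and ?p = "\<lambda>s. ?N #>\<^bsub>F\<^esub> s"
  have p_hom: "?p \<in> hom (F\<lparr>carrier := ?S\<rparr>) ?Q"
    using NS.r_coset_hom_Mod by simp
  \<comment> \<open>This is centrality of S/N in R/N: the two elements differ by a generator of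
    \<open>?N\<close>.\<close>
  have p_conj: "?p (r \<otimes>\<^bsub>F\<^esub> s \<otimes>\<^bsub>F\<^esub> inv\<^bsub>F\<^esub> r) = ?p s" if "r \<in> R" "s \<in> ?S" for r s
    using comm[OF that] that R.mem_carrier by (intro coset_eq) auto
  interpret Q: comm_group ?Q
  proof (rule group.group_comm_groupI[OF NS.factorgroup_is_group])
    fix u v assume "u \<in> carrier ?Q" "v \<in> carrier ?Q"
    then obtain a b where ab: "a \<in> ?S" "b \<in> ?S" "u = ?p a" "v = ?p b"
      by (auto simp: carrier_FactGroup)
    \<comment> \<open>The quotient of ab by ba is the commutator of a and b, which lies in
      \<open>?N\<close> because a in \<open>?S\<close> is also in R.\<close>
    have "a \<otimes>\<^bsub>F\<^esub> b \<otimes>\<^bsub>F\<^esub> inv\<^bsub>F\<^esub> (b \<otimes>\<^bsub>F\<^esub> a) = a \<otimes>\<^bsub>F\<^esub> b \<otimes>\<^bsub>F\<^esub> inv\<^bsub>F\<^esub> a \<otimes>\<^bsub>F\<^esub> inv\<^bsub>F\<^esub> b"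
      using ab(1,2) by (simp add: F.inv_mult_group F.m_assoc)
    then have "?p (a \<otimes>\<^bsub>F\<^esub> b) = ?p (b \<otimes>\<^bsub>F\<^esub> a)"
      using ab(1,2) comm[of a b] by (intro coset_eq) auto
    then show "u \<otimes>\<^bsub>?Q\<^esub> v = v \<otimes>\<^bsub>?Q\<^esub> u"
      using hom_mult[OF p_hom, of a b] hom_mult[OF p_hom, of b a] ab by simp
  qed
  obtain B and E :: "'a \<Rightarrow> 'a \<Rightarrow>\<^sub>0 int" where E: "E \<in> hom F (free_Abelian_group B)"
    and E_0: "\<And>g. g \<in> carrier F \<Longrightarrow> E g = 0 \<longleftrightarrow> g \<in> derived F (carrier F)"
    by (rule free_group_derived_kernel[OF assms(1)]) (rule that)
  have S_eq: "?S = {g \<in> carrier ?G. E g = 0}"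
    using E_0 R.mem_carrier by auto
  interpret K: free_abelian_kernel ?G ?Q B E ?p ?S
  proof unfold_locales
    show "?S = {g \<in> carrier ?G. E g = 0}" by (rule S_eq)
    show "E \<in> hom ?G (free_Abelian_group B)"
      using E R.subset by (auto simp: hom_def)
  qed (use p_hom p_conj inv_G in simp_all)
  \<comment> \<open>The sum of the claim, with the smaller subgroups taken inside \<open>?G\<close>
    to match the locale; the repeated carrier updates collapse in the last line of the
    proof.\<close>
  let ?J = "augmentation_power ?G 3 <+>\<^bsub>group_ring ?G\<^esub>
    additive_product (group_ring ?G) (\<Delta> ?G) (\<Delta> (?G\<lparr>carrier := ?S\<rparr>)) <+>\<^bsub>group_ring ?G\<^esub>
    \<Delta> (?G\<lparr>carrier := ?N\<rparr>)"
  have "one_plus_inter ?G ?J = ?N"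
  proof (intro equalityI subsetI)
    fix w assume w: "w \<in> one_plus_inter ?G ?J"
    have "?p n = \<one>\<^bsub>?Q\<^esub>" if "n \<in> ?N" for n
      using F.coset_join2[OF N.mem_carrier[OF that] N_sub that] by simp
    from K.one_plus_inter_subset[OF N_S this w] have "w \<in> ?S" "?p w = ?N" by auto
    then show "w \<in> ?N" using F.coset_join1[OF _ _ N_sub] S.mem_carrier by blast
  next
    fix w assume w: "w \<in> ?N"
    then have wR: "w \<in> R" using N_S by blast
    \<comment> \<open>In this direction w - 1 lies in the third summand already, so the other two
      only have to contain 0, the neutral element of a generated subgroup.\<close>
    have zero: "0 \<in> augmentation_power ?G 3"
      "0 \<in> additive_product (group_ring ?G) (\<Delta> ?G) (\<Delta> (?G\<lparr>carrier := ?S\<rparr>))"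
      using generate.one[of "add_monoid (group_ring ?G)"]
      by (simp_all add: numeral_3_eq_3 additive_product_def)
    have "frag_of w - frag_of \<one>\<^bsub>F\<^esub> \<in> \<Delta> (?G\<lparr>carrier := ?N\<rparr>)"
      using w by (intro frag_of_diff_in_augmentation_ideal) simp_all
    with zero have "0 + 0 + (frag_of w - frag_of \<one>\<^bsub>F\<^esub>) \<in> ?J"
      unfolding set_add_def set_mult_def by fastforce
    then show "w \<in> one_plus_inter ?G ?J"
      using wR by (simp add: one_plus_inter_def G.group_ring_minus)
  qed
  then show ?thesis by simp
qed

end
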